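(* Let $A$ be a unital C*-algebra. Let $\mathcal F$ be the frame of all families $\underline U=(\underline U(C))_{C\in\mathcal C(A)}$ with $\underline U(C)\subseteq L_C$ such that (i) if $D^C_a\in\underline U(C)$ and $C\subseteq C'$ then $D^{C'}_a\in\underline U(C')$, and (ii) for every $C\in\mathcal C(A)$ and every $D^C_a\in L_C$: $D^C_a\in\underline U(C)$ iff $D^C_a\vartriangleleft_C\underline U(C)$; with meets $(\underline U\wedge\underline V)(C)=\underline U(C)\cap\underline V(C)$, top element $C\mapsto L_C$, and joins $(\bigvee_i\underline U_i)(C)=\{D^C_a\in L_C\mid D^C_a\vartriangleleft_C\bigcup_i\underline U_i(C)\}$. Then the map $$\Psi:\mathcal F\to\mathcal O\Sigma_\ast,\qquad \Psi(\underline U)_C=\bigcup_{D^C_a\in\underline U(C)}X^C_a,$$ is well defined (i.e. $\Psi(\underline U)$ is open in $\Sigma_\ast$) and is an isomorphism of frames: it is bijective and preserves finite meets and arbitrary joins.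
   Context: Let $A$ be a unital C*-algebra. $\mathcal C(A)$ is the poset (under inclusion) of commutative C*-subalgebras of $A$ containing the unit of $A$ (including $\mathbb C\cdot1$). For $C\in\mathcal C(A)$, $\Sigma_C$ is its Gelfand spectrum; for $C\subseteq C'$ and $\lambda'\in\Sigma_{C'}$, $\lambda'|_C$ is the restriction. For $C\in\mathcal C(A)$: $C^+=\{a\in C_{sa}\mid a\ge0\}$; $a\precsim b$ iff $a\le nb$ for some $n\in\mathbb N$; $L_C$ is the set of classes of $C^+$ under $a\approx b\iff(a\precsim b\wedge b\precsim a)$, a distributive lattice ordered by $\precsim$ with $[x]\vee[y]=[x\vee y]$. For $a\in C_{sa}$, $D^C_a:=[a^+]$ ($a^+$ the positive part); $D^C_{a-q}:=[(a-q\cdot1)^+]$. For $U\subseteq L_C$, $D^C_a\vartriangleleft_C U$ iff for every rational $q>0$ there is a finite $U_0\subseteq U$ with $D^C_{a-q}\le\bigvee U_0$. For $a\in C_{sa}$, $X^C_a=\{\lambda\in\Sigma_C\mid\lambda(a)>0\}$ (it depends only on $D^C_a$). Let $\Sigma=\{(C,\lambda)\mid C\in\mathcal C(A),\lambda\in\Sigma_C\}$ and $U_C=\{\lambda\mid(C,\lambda)\in U\}$. The space $\Sigma_\ast$ is $\Sigma$ with the topology $\mathcal O\Sigma_\ast$: $U$ is open iff (1) each $U_C$ is open in $\Sigma_C$, and (2) if $\lambda\in U_C$, $C\subseteq C'$ and $\lambda'\in\Sigma_{C'}$ with $\lambda'|_C=\lambda$, then $\lambda'\in U_{C'}$. ($\mathcal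 F$ is the external description, at the bottom context $\mathbb C\cdot 1$, of the frame of the internal Gelfand spectrum of the Bohrification $\underline A$ in $[\mathcal C(A),\mathbf{Set}]$.) *)

theory Defs
  imports "HOL-Analysis.Analysis"
begin

definition cstar_algebra ::
  "(complex \<Rightarrow> 'a::{real_normed_algebra_1,banach} \<Rightarrow> 'a) \<Rightarrow> ('a \<Rightarrow> 'a) \<Rightarrow> bool" where
  "cstar_algebra sc st \<longleftrightarrow>
     (\<forall>r x. sc (complex_of_real r) x = r *\<^sub>R x) \<and>
     (\<forall>z w x. sc (z + w) x = sc z x + sc w x) \<and>
     (\<forall>z x y. sc z (x + y) = sc z x + sc z y) \<and>
     (\<forall>z w x. sc z (sc w x) = sc (z * w) x) \<and>
     (\<forall>z x y. sc z (x * y) = sc z x * y \<and> sc z (x * y) = x * sc z y) \<and>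
     (\<forall>z x. norm (sc z x) = cmod z * norm x) \<and>
     (\<forall>x y. st (x + y) = st x + st y) \<and>
     (\<forall>z x. st (sc z x) = sc (cnj z) (st x)) \<and>
     (\<forall>x y. st (x * y) = st y * st x) \<and>
     (\<forall>x. st (st x) = x) \<and>
     (\<forall>x. norm (st x * x) = (norm x)\<^sup>2)"

definition alg_invertible :: "'a::real_normed_algebra_1 \<Rightarrow> bool" where
  "alg_invertible x \<longleftrightarrow> (\<exists>y. x * y = 1 \<and> y * x = 1)"

definition cpositive :: "(complex \<Rightarrow> 'a::real_normed_algebra_1 \<Rightarrow> 'a) \<Rightarrow> ('a \<Rightarrow> 'a) \<Rightarrow> 'a \<Rightarrow> bool" where
  "cpositive sc st a \<longleftrightarrow> st a = a \<and>
     (\<forall>z. z \<notin> {complex_of_real r | r. r \<ge> 0} \<longrightarrow> alg_invertible (a - sc z 1))"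

definition cle :: "(complex \<Rightarrow> 'a::real_normed_algebra_1 \<Rightarrow> 'a) \<Rightarrow> ('a \<Rightarrow> 'a) \<Rightarrow> 'a \<Rightarrow> 'a \<Rightarrow> bool" where
  "cle sc st a b \<longleftrightarrow> cpositive sc st (b - a)"

definition precsim :: "(complex \<Rightarrow> 'a::real_normed_algebra_1 \<Rightarrow> 'a) \<Rightarrow> ('a \<Rightarrow> 'a) \<Rightarrow> 'a \<Rightarrow> 'a \<Rightarrow> bool" where
  "precsim sc st a b \<longleftrightarrow> (\<exists>n::nat. cle sc st a (of_nat n * b))"

definition comm_subalg :: "(complex \<Rightarrow> 'a::real_normed_algebra_1 \<Rightarrow> 'a) \<Rightarrow> ('a \<Rightarrow> 'a) \<Rightarrow> 'a set \<Rightarrow> bool" where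
  "comm_subalg sc st C \<longleftrightarrow> 1 \<in> C \<and>
     (\<forall>x\<in>C. \<forall>y\<in>C. x + y \<in> C \<and> x * y \<in> C \<and> x * y = y * x) \<and>
     (\<forall>z. \<forall>x\<in>C. sc z x \<in> C) \<and> (\<forall>x\<in>C. st x \<in> C) \<and> closed C"

definition CA :: "(complex \<Rightarrow> 'a::real_normed_algebra_1 \<Rightarrow> 'a) \<Rightarrow> ('a \<Rightarrow> 'a) \<Rightarrow> 'a set set" where
  "CA sc st = {C. comm_subalg sc st C}"

definition Csa :: "('a \<Rightarrow> 'a) \<Rightarrow> 'a set \<Rightarrow> 'a set" where
  "Csa st C = {a\<in>C. st a = a}"

definition Cplus :: "(complex \<Rightarrow> 'a::real_normed_algebra_1 \<Rightarrow> 'a) \<Rightarrow> ('a \<Rightarrow> 'a) \<Rightarrow> 'a set \<Rightarrow> 'a set" where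
  "Cplus sc st C = {a\<in>Csa st C. cpositive sc st a}"

definition Lcls :: "(complex \<Rightarrow> 'a::real_normed_algebra_1 \<Rightarrow> 'a) \<Rightarrow> ('a \<Rightarrow> 'a) \<Rightarrow> 'a set \<Rightarrow> 'a \<Rightarrow> 'a set" where
  "Lcls sc st C a = {b\<in>Cplus sc st C. precsim sc st a b \<and> precsim sc st b a}"

definition LC :: "(complex \<Rightarrow> 'a::real_normed_algebra_1 \<Rightarrow> 'a) \<Rightarrow> ('a \<Rightarrow> 'a) \<Rightarrow> 'a set \<Rightarrow> 'a set set" where
  "LC sc st C = Lcls sc st C ` Cplus sc st C"

definition Lle :: "(complex \<Rightarrow> 'a::real_normed_algebra_1 \<Rightarrow> 'a) \<Rightarrow> ('a \<Rightarrow> 'a) \<Rightarrow> 'a set \<Rightarrow> 'a set \<Rightarrow> bool" where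
  "Lle sc st X Y \<longleftrightarrow> (\<exists>a\<in>X. \<exists>b\<in>Y. precsim sc st a b)"

definition Ljoin :: "(complex \<Rightarrow> 'a::real_normed_algebra_1 \<Rightarrow> 'a) \<Rightarrow> ('a \<Rightarrow> 'a) \<Rightarrow> 'a set \<Rightarrow> 'a set set \<Rightarrow> 'a set" where
  "Ljoin sc st C U0 = (THE u. u \<in> LC sc st C \<and> (\<forall>x\<in>U0. Lle sc st x u) \<and>
       (\<forall>v\<in>LC sc st C. (\<forall>x\<in>U0. Lle sc st x v) \<longrightarrow> Lle sc st u v))"

definition pos_part :: "(complex \<Rightarrow> 'a::real_normed_algebra_1 \<Rightarrow> 'a) \<Rightarrow> ('a \<Rightarrow> 'a) \<Rightarrow> 'a \<Rightarrow> 'a" where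
  "pos_part sc st a = (THE p. \<exists>m. cpositive sc st p \<and> cpositive sc st m \<and> p * m = 0 \<and> a = p - m)"

definition DD :: "(complex \<Rightarrow> 'a::real_normed_algebra_1 \<Rightarrow> 'a) \<Rightarrow> ('a \<Rightarrow> 'a) \<Rightarrow> 'a set \<Rightarrow> 'a \<Rightarrow> 'a set" where
  "DD sc st C a = Lcls sc st C (pos_part sc st a)"

definition covers :: "(complex \<Rightarrow> 'a::real_normed_algebra_1 \<Rightarrow> 'a) \<Rightarrow> ('a \<Rightarrow> 'a) \<Rightarrow> 'a set \<Rightarrow> 'a \<Rightarrow> 'a set set \<Rightarrow> bool" where
  "covers sc st C a U \<longleftrightarrow> (\<forall>q\<in>\<rat>. q > 0 \<longrightarrow>
     (\<exists>U0. finite U0 \<and> U0 \<subseteq> U \<and>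
        Lle sc st (DD sc st C (a - of_real q)) (Ljoin sc st C U0)))"

definition characters :: "(complex \<Rightarrow> 'a::real_normed_algebra_1 \<Rightarrow> 'a) \<Rightarrow> 'a set \<Rightarrow> ('a \<Rightarrow> complex) set" where
  "characters sc C = {l \<in> extensional C.
     (\<forall>x\<in>C. \<forall>y\<in>C. l (x + y) = l x + l y \<and> l (x * y) = l x * l y) \<and>
     (\<forall>z. \<forall>x\<in>C. l (sc z x) = z * l x) \<and> l 1 = 1}"

definition gelfand_top :: "(complex \<Rightarrow> 'a::real_normed_algebra_1 \<Rightarrow> 'a) \<Rightarrow> 'a set \<Rightarrow> ('a \<Rightarrow> complex) topology" where
  "gelfand_top sc C = subtopology (product_topology (\<lambda>_. euclidean) C) (characters sc C)"

definition Xa :: "(complex \<Rightarrow> 'a::real_normed_algebra_1 \<Rightarrow> 'a) \<Rightarrow> 'a set \<Rightarrow> 'a \<Rightarrow> ('a \<Rightarrow> complex) set" where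
  "Xa sc C a = {l \<in> characters sc C. Re (l a) > 0}"

definition SigmaAll :: "(complex \<Rightarrow> 'a::real_normed_algebra_1 \<Rightarrow> 'a) \<Rightarrow> ('a \<Rightarrow> 'a) \<Rightarrow> ('a set \<times> ('a \<Rightarrow> complex)) set" where
  "SigmaAll sc st = {(C, l). C \<in> CA sc st \<and> l \<in> characters sc C}"

definition OSigma :: "(complex \<Rightarrow> 'a::real_normed_algebra_1 \<Rightarrow> 'a) \<Rightarrow> ('a \<Rightarrow> 'a) \<Rightarrow> ('a set \<times> ('a \<Rightarrow> complex)) set set" where
  "OSigma sc st = {U. U \<subseteq> SigmaAll sc st \<and>
     (\<forall>C\<in>CA sc st. openin (gelfand_top sc C) {l. (C, l) \<in> U}) \<and>
     (\<forall>C l C' l'. (C, l) \<in> U \<longrightarrow> C' \<in> CA sc st \<longrightarrow> C \<subseteq> C' \<longrightarrow>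
        l' \<in> characters sc C' \<longrightarrow> restrict l' C = l \<longrightarrow> (C', l') \<in> U)}"

definition Fam :: "(complex \<Rightarrow> 'a::real_normed_algebra_1 \<Rightarrow> 'a) \<Rightarrow> ('a \<Rightarrow> 'a) \<Rightarrow> ('a set \<Rightarrow> 'a set set) set" where
  "Fam sc st = {U.
     (\<forall>C. C \<notin> CA sc st \<longrightarrow> U C = {}) \<and>
     (\<forall>C\<in>CA sc st. U C \<subseteq> LC sc st C) \<and>
     (\<forall>C\<in>CA sc st. \<forall>C'\<in>CA sc st. \<forall>a\<in>Csa st C.
        DD sc st C a \<in> U C \<and> C \<subseteq> C' \<longrightarrow> DD sc st C' a \<in> U C') \<and>
     (\<forall>C\<in>CA sc st. \<forall>a\<in>Csa st C. DD sc st C a \<in> U C \<longleftrightarrow> covers sc st C a (U C))}"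

definition Fmeet :: "('a set \<Rightarrow> 'a set set) \<Rightarrow> ('a set \<Rightarrow> 'a set set) \<Rightarrow> 'a set \<Rightarrow> 'a set set" where
  "Fmeet U V = (\<lambda>C. U C \<inter> V C)"

definition Ftop :: "(complex \<Rightarrow> 'a::real_normed_algebra_1 \<Rightarrow> 'a) \<Rightarrow> ('a \<Rightarrow> 'a) \<Rightarrow> 'a set \<Rightarrow> 'a set set" where
  "Ftop sc st = (\<lambda>C. if C \<in> CA sc st then LC sc st C else {})"

definition Fjoin :: "(complex \<Rightarrow> 'a::real_normed_algebra_1 \<Rightarrow> 'a) \<Rightarrow> ('a \<Rightarrow> 'a) \<Rightarrow> ('a set \<Rightarrow> 'a set set) set \<Rightarrow> 'a set \<Rightarrow> 'a set set" where
  "Fjoin sc st Us = (\<lambda>C. if C \<in> CA sc st then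
      {D \<in> LC sc st C. \<exists>a\<in>Csa st C. D = DD sc st C a \<and> covers sc st C a (\<Union>U\<in>Us. U C)}
    else {})"

definition Psi :: "(complex \<Rightarrow> 'a::real_normed_algebra_1 \<Rightarrow> 'a) \<Rightarrow> ('a \<Rightarrow> 'a) \<Rightarrow> ('a set \<Rightarrow> 'a set set) \<Rightarrow> ('a set \<times> ('a \<Rightarrow> complex)) set" where
  "Psi sc st U = {(C, l). C \<in> CA sc st \<and> l \<in> characters sc C \<and>
      (\<exists>a\<in>Csa st C. DD sc st C a \<in> U C \<and> l \<in> Xa sc C a)}"

end

theory Submission
  imports Defs
begin

text \<open>
For commutative $C$, compactness of $\Sigma_C$ turns the covering relation into set inclusion:
$D^C_a \vartriangleleft_C U$ iff $X^C_a \subseteq \bigcup_{D \in U} X_D$. Hence a family in $\mathcal F$ is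
determined at $C$ by the open set $\bigcup_{D \in \underline U(C)} X_D$, namely
$D^C_a \in \underline U(C)$ iff $X^C_a$ is contained in it, and, the sets $X^C_a$ being a base of $\Sigma_C$,
the inverse of $\Psi$ sends $W$ to $C \mapsto \{D \mid X_D \subseteq W_C\}$.

The Gelfand theory this needs is obtained without Gelfand--Mazur. The self-adjoint elements with
$\|t - a\| \le t$ for some $t \ge 0$ form an Archimedean preordering of the real algebra $C_{sa}$; a
maximal preordering $Q$ containing it is total, so every $a$ differs from a unique real number by an
element that is infinitesimal for $Q$, and this standard part extends to a character of $C$.
\<close>

section \<open>The positive cone of a commutative subalgebra\<close>

text \<open>The definitions look beyond \<open>C\<close>: \<open>cpositive\<close> asks for inverses
  anywhere in the ambient algebra, and \<open>pos_part\<close> ranges over all ambient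
  decompositions. Gelfand theory for a single \<open>C\<close> is therefore not enough;
  \<open>ch_cpositive\<close> and \<open>pos_part_eq\<close> bridge the gap, so that order and
  positive part become pointwise notions on the spectrum of any commutative subalgebra containing
  the elements.

  The analytic input is a pair of contractions, one for inverses and one for square roots of
  \<open>1 - y\<close>. The delicate point is that the cone contains squares: it rests on the
  C*-identity for complex combinations of self-adjoint elements and is what yields closure under
  products. Square roots are available only after a positive shift, so many facts hold first up to
  an epsilon and then exactly because the cone is closed. Strictness is likewise lost when passing
  to standard parts, and is regained by shifting.\<close>

locale cstar =
  fixes sc :: "complex \<Rightarrow> 'a::{real_normed_algebra_1,banach} \<Rightarrow> 'a"
    and st :: "'a \<Rightarrow> 'a"
  assumes cstar: "cstar_algebra sc st"
begin

lemma sc_of_real: "sc (complex_of_real r) x = r *\<^sub>R x"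
  and sc_add_left: "sc (z + w) x = sc z x + sc w x"
  and sc_add_right: "sc z (x + y) = sc z x + sc z y"
  and sc_sc: "sc z (sc w x) = sc (z * w) x"
  and sc_mult_left: "sc z x * y = sc z (x * y)"
  and sc_mult_right: "x * sc z y = sc z (x * y)"
  and norm_sc: "norm (sc z x) = cmod z * norm x"
  and st_add: "st (x + y) = st x + st y"
  and st_sc: "st (sc z x) = sc (cnj z) (st x)"
  and st_mult: "st (x * y) = st y * st x"
  and st_st: "st (st x) = x"
  and norm_st_mult: "norm (st x * x) = (norm x)\<^sup>2"
  using cstar unfolding cstar_algebra_def by metis+

lemma sc_0 [simp]: "sc 0 x = 0" "sc z 0 = 0"
  using sc_of_real[of 0 x] norm_sc[of z 0] by simp_all

lemma sc_1 [simp]: "sc 1 x = x"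
  using sc_of_real[of 1 x] by simp

lemma sc_minus_left: "sc (- z) x = - sc z x"
  using sc_add_left[of z "- z" x] by (simp add: eq_neg_iff_add_eq_0 add.commute)

lemma sc_minus_right: "sc z (- x) = - sc z x"
  using sc_add_right[of z x "- x"] by (simp add: eq_neg_iff_add_eq_0 add.commute)

lemma sc_diff_right: "sc z (x - y) = sc z x - sc z y"
  using sc_add_right[of z x "- y"] by (simp add: sc_minus_right)

lemma sc_scaleR: "sc z (r *\<^sub>R x) = r *\<^sub>R sc z x"
  using sc_sc[of z "complex_of_real r" x] sc_sc[of "complex_of_real r" z x]
  by (simp add: sc_of_real mult.commute)

lemma sc_Complex: "sc (Complex x y) a = x *\<^sub>R a + y *\<^sub>R sc \<i> a"
  using sc_add_left[of "complex_of_real x" "complex_of_real y * \<i>" a]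
    sc_sc[of "complex_of_real y" \<i> a]
  by (simp add: Complex_eq sc_of_real mult.commute)

lemma st_0 [simp]: "st 0 = 0"
  using st_add[of 0 0] by simp

lemma st_minus: "st (- x) = - st x"
  using st_add[of x "- x"] by (simp add: eq_neg_iff_add_eq_0 add.commute)

lemma st_diff: "st (x - y) = st x - st y"
  using st_add[of x "- y"] by (simp add: st_minus)

lemma st_scaleR: "st (r *\<^sub>R x) = r *\<^sub>R st x"
  using st_sc[of "complex_of_real r" x] by (simp add: sc_of_real)

lemma st_1 [simp]: "st 1 = 1"
  by (metis mult_1 mult.right_neutral st_mult st_st)

lemma norm_st: "norm (st x) = norm x"
proof -
  have "norm y \<le> norm (st y)" for y
  proof (cases "y = 0")
    case False
    have "norm y * norm y \<le> norm (st y) * norm y"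
      using norm_st_mult[of y] norm_mult_ineq[of "st y" y] by (simp add: power2_eq_square)
    then show ?thesis using False by simp
  qed simp
  from this[of x] this[of "st x"] show ?thesis by (simp add: st_st)
qed

lemma norm_sa_square: "st a = a \<Longrightarrow> norm (a * a) = (norm a)\<^sup>2"
  using norm_st_mult[of a] by simp

lemma continuous_on_st: "continuous_on S st"
proof (rule continuous_onI)
  fix x e assume "x \<in> S" "(0::real) < e"
  then show "\<exists>d>0. \<forall>x'\<in>S. dist x' x < d \<longrightarrow> dist (st x') (st x) \<le> e"
    by (intro exI[of _ e]) (auto simp: dist_norm norm_st simp flip: st_diff)
qed

end

locale csub = cstar sc st
  for sc :: "complex \<Rightarrow> 'a::{real_normed_algebra_1,banach} \<Rightarrow> 'a" and st :: "'a \<Rightarrow> 'a" +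
  fixes C :: "'a set"
  assumes C: "C \<in> CA sc st"
begin

lemma C_1 [simp]: "1 \<in> C"
  and C_add: "x \<in> C \<Longrightarrow> y \<in> C \<Longrightarrow> x + y \<in> C"
  and C_mult: "x \<in> C \<Longrightarrow> y \<in> C \<Longrightarrow> x * y \<in> C"
  and C_comm: "x \<in> C \<Longrightarrow> y \<in> C \<Longrightarrow> x * y = y * x"
  and C_sc: "x \<in> C \<Longrightarrow> sc z x \<in> C"
  and C_st: "x \<in> C \<Longrightarrow> st x \<in> C"
  and C_closed: "closed C"
  using C unfolding CA_def comm_subalg_def by auto

lemma C_scaleR: "x \<in> C \<Longrightarrow> r *\<^sub>R x \<in> C"
  using C_sc[of x "complex_of_real r"] by (simp add: sc_of_real)

lemma C_minus: "x \<in> C \<Longrightarrow> - x \<in> C"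
  using C_scaleR[of x "-1"] by simp

lemma C_diff: "x \<in> C \<Longrightarrow> y \<in> C \<Longrightarrow> x - y \<in> C"
  using C_add[of x "- y"] C_minus by simp

lemma C_0 [simp]: "0 \<in> C"
  using C_scaleR[of 1 0] by simp

abbreviation S :: "'a set" where "S \<equiv> Csa st C"

lemma S_C: "a \<in> S \<Longrightarrow> a \<in> C"
  and S_st: "a \<in> S \<Longrightarrow> st a = a"
  and S_I: "a \<in> C \<Longrightarrow> st a = a \<Longrightarrow> a \<in> S"
  by (auto simp: Csa_def)

lemma S_1 [simp]: "1 \<in> S"
  and S_0 [simp]: "0 \<in> S"
  and S_add: "x \<in> S \<Longrightarrow> y \<in> S \<Longrightarrow> x + y \<in> S"
  and S_diff: "x \<in> S \<Longrightarrow> y \<in> S \<Longrightarrow> x - y \<in> S"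
  and S_minus: "x \<in> S \<Longrightarrow> - x \<in> S"
  and S_scaleR: "x \<in> S \<Longrightarrow> r *\<^sub>R x \<in> S"
  by (auto simp: Csa_def C_add C_diff C_minus C_scaleR st_add st_diff st_minus st_scaleR)

lemma S_mult: "x \<in> S \<Longrightarrow> y \<in> S \<Longrightarrow> x * y \<in> S"
  by (auto simp: Csa_def C_mult st_mult C_comm)

lemma S_sum: "(\<And>i. i \<in> I \<Longrightarrow> f i \<in> S) \<Longrightarrow> (\<Sum>i\<in>I. f i) \<in> S"
  by (induction I rule: infinite_finite_induct) (auto simp: S_add)

lemma S_comm: "x \<in> S \<Longrightarrow> y \<in> S \<Longrightarrow> x * y = y * x"
  by (auto simp: Csa_def C_comm)

lemma S_closed: "closed S"
proof -
  have "closed {a. st a = a}"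
    using continuous_on_st[of UNIV] by (intro closed_Collect_eq) (auto intro: continuous_intros)
  moreover have "S = C \<inter> {a. st a = a}" by (auto simp: Csa_def)
  ultimately show ?thesis using C_closed by auto
qed

section \<open>Inverses and square roots inside the subalgebra\<close>

lemma neumann:
  assumes "y \<in> C" "norm y < 1"
  shows "\<exists>u\<in>C. (1 - y) * u = 1"
proof -
  \<comment> \<open>The Neumann series as a fixed point: the contraction acts on the closed set
    \<open>C\<close>, so the inverse stays in the subalgebra.\<close>
  have "\<exists>!u\<in>C. 1 + y * u = u"
  proof (rule Banach_fix[where c = "norm y"])
    show "complete C" using C_closed by (simp add: complete_eq_closed)
    show "(\<lambda>u. 1 + y * u) ` C \<subseteq> C" using assms by (auto intro: C_add C_mult)
    show "C \<noteq> {}" using C_1 by blast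
    show "dist (1 + y * u) (1 + y * v) \<le> norm y * dist u v" for u v
      using norm_mult_ineq[of y "u - v"] by (simp add: dist_norm right_diff_distrib)
  qed (use assms in auto)
  then obtain u where u: "u \<in> C" "1 + y * u = u" by blast
  then have "(1 - y) * u = 1" by (simp add: left_diff_distrib) (metis add_diff_cancel_right')
  then show ?thesis using u by blast
qed

lemma inverse_near_scalar:
  assumes "x \<in> C" "norm (t *\<^sub>R 1 - x) < t"
  shows "\<exists>u\<in>C. x * u = 1"
proof -
  have t: "t > 0" using assms(2) norm_ge_zero[of "t *\<^sub>R 1 - x"] by linarith
  define y where "y = (1/t) *\<^sub>R (t *\<^sub>R 1 - x)"
  have "norm y = norm (t *\<^sub>R 1 - x) / t" using t by (simp add: y_def)
  then have "norm y < 1" using assms(2) t by simp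
  moreover have "y \<in> C" using assms by (auto simp: y_def intro!: C_scaleR C_diff)
  ultimately obtain u where u: "u \<in> C" "(1 - y) * u = 1" using neumann by blast
  have "1 - y = (1/t) *\<^sub>R x" using t by (simp add: y_def scaleR_diff_right)
  then have "x * ((1/t) *\<^sub>R u) = 1" using u by simp
  then show ?thesis using u C_scaleR by blast
qed

text \<open>With \<open>s = 1 - w\<close> the equation becomes \<open>w = (y + w * w) / 2\<close>,
  whose right side contracts by the factor \<open>norm y\<close> on the self-adjoint ball of that
  radius. The bound on \<open>1 - s\<close> is exactly what puts \<open>s\<close> into the cone,
  with parameter 1.\<close>

lemma sqrt_one_minus:
  assumes y: "y \<in> S" "norm y < 1"
  shows "\<exists>s\<in>S. s * s = 1 - y \<and> norm (1 - s) \<le> 1"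
proof -
  define B where "B = S \<inter> cball 0 (norm y)"
  define f where "f = (\<lambda>w. (1/2) *\<^sub>R (y + w * w))"
  have "\<exists>!w\<in>B. f w = w"
  proof (rule Banach_fix[where c = "norm y"])
    show "complete B" unfolding B_def complete_eq_closed using S_closed by blast
    have "0 \<in> B" by (simp add: B_def)
    then show "B \<noteq> {}" by blast
    show "f ` B \<subseteq> B"
    proof (rule image_subsetI)
      fix w assume w: "w \<in> B"
      have "norm (w * w) \<le> norm y * norm y"
        using norm_mult_ineq[of w w] w mult_mono[of "norm w" "norm y" "norm w" "norm y"]
        by (simp add: B_def)
      also have "\<dots> \<le> norm y" using y mult_left_mono[of "norm y" 1 "norm y"] by simp
      finally have "norm (w * w) \<le> norm y" .
      then have "norm (f w) \<le> norm y"
        using norm_triangle_ineq[of y "w * w"] by (simp add: f_def)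
      moreover have "f w \<in> S" using w y by (auto simp: f_def B_def intro!: S_scaleR S_add S_mult)
      ultimately show "f w \<in> B" by (simp add: B_def)
    qed
    fix v w assume vw: "v \<in> B" "w \<in> B"
    have "v * v - w * w = (v + w) * (v - w)"
      using vw S_comm[of v w] by (simp add: algebra_simps B_def)
    then have "f v - f w = (1/2) *\<^sub>R ((v + w) * (v - w))"
      by (simp add: f_def flip: scaleR_diff_right)
    then have "norm (f v - f w) \<le> (1/2) * (norm (v + w) * norm (v - w))"
      using norm_mult_ineq[of "v + w" "v - w"] by simp
    also have "\<dots> \<le> (1/2) * (2 * norm y * norm (v - w))"
      using norm_triangle_ineq[of v w] vw by (intro mult_left_mono mult_right_mono) (auto simp: B_def)
    finally show "dist (f v) (f w) \<le> norm y * dist v w" by (simp add: dist_norm)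
  qed (use y in auto)
  then obtain w where w: "w \<in> B" "f w = w" by blast
  have "2 *\<^sub>R f w = y + w * w" by (simp add: f_def)
  then have "y + w * w = w + w" using w by (simp add: scaleR_2)
  then have "(1 - w) * (1 - w) = 1 - y" by (simp add: algebra_simps)
  moreover have "1 - w \<in> S" using w by (auto simp: B_def intro: S_diff)
  moreover have "norm (1 - (1 - w)) \<le> 1" using w y by (simp add: B_def)
  ultimately show ?thesis by blast
qed

text \<open>The positive cone, described through the norm only; sums and the order unit are then immediate.\<close>

definition K :: "'a set" where
  "K = {a \<in> S. \<exists>t\<ge>0. norm (t *\<^sub>R 1 - a) \<le> t}"

lemma K_S: "a \<in> K \<Longrightarrow> a \<in> S"
  by (simp add: K_def)

lemma K_add:
  assumes "a \<in> K" "b \<in> K"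
  shows "a + b \<in> K"
proof -
  obtain t u where "t \<ge> 0" "norm (t *\<^sub>R 1 - a) \<le> t" "u \<ge> 0" "norm (u *\<^sub>R 1 - b) \<le> u"
    using assms by (auto simp: K_def)
  then have "norm ((t + u) *\<^sub>R 1 - (a + b)) \<le> t + u \<and> t + u \<ge> 0"
    using norm_triangle_ineq[of "t *\<^sub>R 1 - a" "u *\<^sub>R 1 - b"] by (simp add: algebra_simps)
  then show ?thesis using assms S_add by (auto simp: K_def)
qed

lemma K_scaleR:
  assumes "a \<in> K" "r \<ge> 0"
  shows "r *\<^sub>R a \<in> K"
proof -
  obtain t where t: "t \<ge> 0" "norm (t *\<^sub>R 1 - a) \<le> t" using assms by (auto simp: K_def)
  have "norm ((r * t) *\<^sub>R 1 - r *\<^sub>R a) = r * norm (t *\<^sub>R 1 - a)"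
    using assms by (simp flip: scaleR_scaleR scaleR_diff_right)
  then have "norm ((r * t) *\<^sub>R 1 - r *\<^sub>R a) \<le> r * t" using t assms by (simp add: mult_left_mono)
  then show ?thesis using assms t S_scaleR by (auto simp: K_def intro!: exI[of _ "r * t"])
qed

lemma K_scalar: "r \<ge> 0 \<Longrightarrow> r *\<^sub>R 1 \<in> K"
  by (auto simp: K_def S_scaleR intro!: exI[of _ r])

lemma K_0 [simp]: "0 \<in> K" and K_1 [simp]: "1 \<in> K"
  using K_scalar[of 0] K_scalar[of 1] by simp_all

lemma K_order_unit:
  assumes "a \<in> S" "norm a \<le> t"
  shows "t *\<^sub>R 1 - a \<in> K" "t *\<^sub>R 1 + a \<in> K"
proof -
  have "t \<ge> 0" using assms norm_ge_zero[of a] by linarith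
  then show "t *\<^sub>R 1 - a \<in> K" "t *\<^sub>R 1 + a \<in> K"
    using assms by (auto simp: K_def intro!: exI[of _ t] S_diff S_add S_scaleR)
qed

text \<open>After the shift the element is \<open>(t + e) * (1 - y)\<close> with
  \<open>norm y \<le> t / (t + e) < 1\<close>. Without the shift this bound, and with it the
  contraction factor, could reach 1.\<close>

lemma K_sqrt:
  assumes a: "a \<in> K" and e: "e > 0"
  shows "\<exists>s\<in>K. s * s = a + e *\<^sub>R 1"
proof -
  obtain t where t: "t \<ge> 0" "norm (t *\<^sub>R 1 - a) \<le> t" using a by (auto simp: K_def)
  define y where "y = (1/(t+e)) *\<^sub>R (t *\<^sub>R 1 - a)"
  have y: "y \<in> S" using K_S[OF a] by (auto simp: y_def intro!: S_scaleR S_diff)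
  have "norm y = norm (t *\<^sub>R 1 - a) / (t + e)" using t e by (simp add: y_def)
  then have "norm y < 1" using t e by simp
  then obtain s where s: "s \<in> S" "s * s = 1 - y" "norm (1 - s) \<le> 1"
    using sqrt_one_minus[OF y] by blast
  have "s \<in> K" using s by (auto simp: K_def intro!: exI[of _ 1])
  then have "sqrt (t + e) *\<^sub>R s \<in> K" using t e by (intro K_scaleR) auto
  moreover have "(sqrt (t + e) *\<^sub>R s) * (sqrt (t + e) *\<^sub>R s) = (t + e) *\<^sub>R (1 - y)"
    using s t e by simp
  moreover have "(t + e) *\<^sub>R y = t *\<^sub>R 1 - a" using t e by (simp add: y_def)
  then have "(t + e) *\<^sub>R (1 - y) = a + e *\<^sub>R 1" by (simp add: algebra_simps)
  ultimately show ?thesis by metis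
qed

text \<open>With $u = b + ic$ the hypothesis says $u^*u = r$, and $b$ is the real part of $u$.\<close>

lemma norm_sum_squares:
  assumes b: "b \<in> S" and c: "c \<in> S" and eq: "b * b + c * c = r *\<^sub>R 1" and r: "r \<ge> 0"
  shows "(norm b)\<^sup>2 \<le> r"
proof -
  define u where "u = b + sc \<i> c"
  have st_u: "st u = b - sc \<i> c"
    using S_st[OF b] S_st[OF c] by (simp add: u_def st_add st_sc sc_minus_left)
  have "st u * u = b * b + c * c"
    using S_comm[OF b c] unfolding st_u unfolding u_def
    by (simp add: algebra_simps sc_mult_left sc_mult_right sc_sc sc_minus_left sc_diff_right sc_add_right)
  then have "(norm u)\<^sup>2 = r" using norm_st_mult[of u] eq r by simp
  moreover have "b = (1/2) *\<^sub>R (u + st u)"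
    unfolding st_u unfolding u_def by (simp flip: scaleR_2)
  then have "norm b \<le> norm u" using norm_triangle_ineq[of u "st u"] by (simp add: norm_st)
  ultimately show ?thesis using power_mono[of "norm b" "norm u" 2] by simp
qed

text \<open>Take \<open>d\<close> with \<open>d * d = t - b * b\<close>. The two squares add up to
  \<open>t\<close>, so \<open>norm_sum_squares\<close> bounds \<open>(norm d)^2\<close>, which is
  the norm of \<open>t - b * b\<close>.\<close>

lemma norm_minus_square:
  assumes b: "b \<in> S" and t: "(norm b)\<^sup>2 < t"
  shows "norm (t *\<^sub>R 1 - b * b) \<le> t"
proof -
  have t0: "t > 0" using t zero_le_power2[of "norm b"] by linarith
  define y where "y = (1/t) *\<^sub>R (b * b)"
  have y: "y \<in> S" using b by (auto simp: y_def intro!: S_scaleR S_mult)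
  have "norm y = (norm b)\<^sup>2 / t" using t0 norm_sa_square[OF S_st[OF b]] by (simp add: y_def)
  then have "norm y < 1" using t t0 by simp
  then obtain s where s: "s \<in> S" "s * s = 1 - y" using sqrt_one_minus[OF y] by blast
  define d where "d = sqrt t *\<^sub>R s"
  have d: "d \<in> S" using s by (simp add: d_def S_scaleR)
  have "d * d = t *\<^sub>R (1 - y)" using s t0 by (simp add: d_def)
  moreover have "t *\<^sub>R y = b * b" using t0 by (simp add: y_def)
  ultimately have dd: "d * d = t *\<^sub>R 1 - b * b" by (simp add: scaleR_diff_right)
  then have "(norm d)\<^sup>2 \<le> t" using t0 by (intro norm_sum_squares[OF d b]) auto
  then show ?thesis using norm_sa_square[OF S_st[OF d]] dd by simp
qed

lemma K_square: "b \<in> S \<Longrightarrow> b * b \<in> K"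
  using norm_minus_square[of b "(norm b)\<^sup>2 + 1"] by (auto simp: K_def S_mult intro!: exI[of _ "(norm b)\<^sup>2 + 1"])

text \<open>Frees the parameter in \<open>K\<close>: any bound on the norm can serve, so it cannot
  escape in a limit. A shift of \<open>a\<close> is a square, to which
  \<open>norm_minus_square\<close> applies; the three thirds of \<open>e\<close> pay for the shift,
  for strictness, and for removing the shift again.\<close>

lemma K_norm:
  assumes a: "a \<in> K" and t: "norm a \<le> t"
  shows "norm (t *\<^sub>R 1 - a) \<le> t"
proof (rule field_le_epsilon)
  fix e :: real assume e: "e > 0"
  define d where "d = e/3"
  have d: "d > 0" using e by (simp add: d_def)
  obtain b where b: "b \<in> K" "b * b = a + d *\<^sub>R 1" using K_sqrt[OF a d] by blast
  have "norm (a + d *\<^sub>R 1) \<le> norm a + d" using norm_triangle_ineq[of a "d *\<^sub>R 1"] d by simp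
  then have "(norm b)\<^sup>2 < t + 2 * d"
    using norm_sa_square[OF S_st[OF K_S[OF b(1)]]] b t d by simp
  from norm_minus_square[OF K_S[OF b(1)] this]
  have "norm ((t + 2 * d) *\<^sub>R 1 - (a + d *\<^sub>R 1)) \<le> t + 2 * d" using b by simp
  also have "(t + 2 * d) *\<^sub>R 1 - (a + d *\<^sub>R 1) = (t *\<^sub>R 1 - a) + d *\<^sub>R 1"
    by (simp add: algebra_simps flip: scaleR_add_left)
  finally have "norm (t *\<^sub>R 1 - a) \<le> t + 2 * d + d"
    using norm_diff_ineq[of "t *\<^sub>R 1 - a" "d *\<^sub>R 1"] d by simp
  then show "norm (t *\<^sub>R 1 - a) \<le> t + e" by (simp add: d_def)
qed

text \<open>The cone is closed, since \<open>K_norm\<close> gives an approximant \<open>y\<close>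
  the parameter \<open>norm x + e/3\<close>, which stays bounded.\<close>

lemma K_approx:
  assumes x: "x \<in> S" and ap: "\<And>e. e > 0 \<Longrightarrow> \<exists>y\<in>K. norm (x - y) \<le> e"
  shows "x \<in> K"
proof -
  have "norm (norm x *\<^sub>R 1 - x) \<le> norm x"
  proof (rule field_le_epsilon)
    fix e :: real assume "e > 0"
    then obtain y where y: "y \<in> K" "norm (x - y) \<le> e/3" using ap[of "e/3"] by auto
    have "norm y \<le> norm x + e/3" using norm_triangle_ineq4[of x "x - y"] y by simp
    from K_norm[OF y(1) this] have 1: "norm ((norm x + e/3) *\<^sub>R 1 - y) \<le> norm x + e/3" .
    have eq: "norm x *\<^sub>R 1 - x = ((norm x + e/3) *\<^sub>R 1 - y) - (x - y) - (e/3) *\<^sub>R 1"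
      by (simp add: algebra_simps)
    have "norm (norm x *\<^sub>R 1 - x) \<le> norm ((norm x + e/3) *\<^sub>R 1 - y) + norm (x - y) + norm ((e/3) *\<^sub>R (1::'a))"
      using arg_cong[OF eq, of norm]
        norm_triangle_ineq4[of "((norm x + e/3) *\<^sub>R 1 - y) - (x - y)" "(e/3) *\<^sub>R 1"]
        norm_triangle_ineq4[of "(norm x + e/3) *\<^sub>R 1 - y" "x - y"] by linarith
    then show "norm (norm x *\<^sub>R 1 - x) \<le> norm x + e" using 1 y \<open>e > 0\<close> by simp
  qed
  then show ?thesis using x by (auto simp: K_def intro!: exI[of _ "norm x"])
qed

text \<open>The roots commute, so \<open>(a + e) * (b + e)\<close> is the square of
  \<open>s * u\<close> and lies in the cone; it tends to \<open>a * b\<close> as \<open>e\<close>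
  tends to 0.\<close>

lemma K_mult:
  assumes a: "a \<in> K" and b: "b \<in> K"
  shows "a * b \<in> K"
proof (rule K_approx)
  note S = K_S[OF a] K_S[OF b]
  show "a * b \<in> S" using S by (rule S_mult)
  fix d :: real assume d: "d > 0"
  \<comment> \<open>The error is \<open>e * (a + b + e)\<close>: the bound 1 on \<open>e\<close>
    controls the last summand, and the quotient then brings the whole to at most
    \<open>d\<close>.\<close>
  define e where "e = min 1 (d / (norm (a + b) + 1))"
  have e: "e > 0" "e \<le> 1" "e * (norm (a + b) + 1) \<le> d"
    using d by (auto simp: e_def min_def field_simps add_pos_nonneg add_nonneg_pos)
  obtain s u where su: "s \<in> K" "s * s = a + e *\<^sub>R 1" "u \<in> K" "u * u = b + e *\<^sub>R 1"
    using K_sqrt[OF a e(1)] K_sqrt[OF b e(1)] by blast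
  have "(s * u) * (s * u) = (s * s) * (u * u)"
    using S_comm[OF K_S[OF su(1)] K_S[OF su(3)]] by (metis mult.assoc)
  then have eq: "a * b - (s * u) * (s * u) = - (e *\<^sub>R (a + b + e *\<^sub>R 1))"
    using su by (simp add: algebra_simps)
  have "norm (a + b + e *\<^sub>R 1) \<le> norm (a + b) + 1"
    using norm_triangle_ineq[of "a + b" "e *\<^sub>R 1"] e by simp
  then have "norm (a * b - (s * u) * (s * u)) \<le> e * (norm (a + b) + 1)"
    unfolding eq norm_minus_cancel norm_scaleR using e by (simp add: mult_left_mono)
  also have "\<dots> \<le> d" by (rule e)
  finally show "\<exists>y\<in>K. norm (a * b - y) \<le> d"
    using K_square[OF S_mult[OF K_S[OF su(1)] K_S[OF su(3)]]] by blast
qed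

lemma minus_one_K: "- 1 \<notin> K"
proof
  assume "- 1 \<in> K"
  then obtain t where "t \<ge> 0" "norm (t *\<^sub>R (1::'a) + 1) \<le> t" by (auto simp: K_def)
  moreover have "t *\<^sub>R (1::'a) + 1 = (t + 1) *\<^sub>R 1" by (simp add: scaleR_add_left)
  ultimately show False by simp
qed

text \<open>The shift keeps the distance to the scalar but raises the admissible radius from
  \<open>t\<close> to \<open>t + r\<close>, which gives the strict bound required by
  \<open>inverse_near_scalar\<close>.\<close>

lemma K_shift_inverse:
  assumes a: "a \<in> K" and r: "r > 0"
  shows "\<exists>u\<in>K. (a + r *\<^sub>R 1) * u = 1"
proof -
  obtain t where t: "t \<ge> 0" "norm (t *\<^sub>R 1 - a) \<le> t" using a by (auto simp: K_def)
  define x where "x = a + r *\<^sub>R 1"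
  have x: "x \<in> K" using K_add[OF a K_scalar[of r]] r by (simp add: x_def)
  have "(t + r) *\<^sub>R 1 - x = t *\<^sub>R 1 - a" by (simp add: x_def algebra_simps)
  then have "norm ((t + r) *\<^sub>R 1 - x) < t + r" using t r by simp
  then obtain u where u: "u \<in> C" "x * u = 1"
    using inverse_near_scalar[OF S_C[OF K_S[OF x]]] by blast
  have ux: "u * x = 1" using u C_comm[OF u(1) S_C[OF K_S[OF x]]] by simp
  have "st (u * x) = x * st u" using S_st[OF K_S[OF x]] by (simp add: st_mult)
  then have "x * st u = 1" by (simp add: ux)
  then have "st u = u" using ux by (metis mult.assoc mult_1 mult.right_neutral)
  then have uS: "u \<in> S" using u by (auto intro: S_I)
  \<comment> \<open>The inverse is a product of \<open>x\<close> and a square, hence in the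
    cone.\<close>
  have "u = x * (u * u)" using u by (metis mult.assoc mult_1)
  then have "u \<in> K" using K_mult[OF x K_square[OF uS]] by simp
  then show ?thesis using u by (auto simp: x_def)
qed

text \<open>Normalizing to \<open>c = (a - Re z) / Im z\<close> leaves \<open>c - i\<close> to
  invert, and \<open>(c - i) * (c + i) = c * c + 1\<close> is a positive shift of a square. The
  inverse lies in \<open>C\<close>, so characters can be evaluated on it.\<close>

lemma nonreal_shift_inverse:
  assumes a: "a \<in> S" and z: "Im z \<noteq> 0"
  shows "\<exists>u\<in>C. (a - sc z 1) * u = 1"
proof -
  define c where "c = (1 / Im z) *\<^sub>R (a - Re z *\<^sub>R 1)"
  have c: "c \<in> S" using a by (auto simp: c_def intro!: S_scaleR S_diff)
  obtain v where v: "v \<in> K" "(c * c + 1) * v = 1"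
    using K_shift_inverse[OF K_square[OF c], of 1] by auto
  have "Im z *\<^sub>R c = a - Re z *\<^sub>R 1" using z by (simp add: c_def)
  moreover have "sc z 1 = Re z *\<^sub>R 1 + Im z *\<^sub>R sc \<i> 1"
    using sc_Complex[of "Re z" "Im z" 1] by simp
  ultimately have az: "a - sc z 1 = Im z *\<^sub>R (c - sc \<i> 1)" by (simp add: algebra_simps)
  have "(c - sc \<i> 1) * (c + sc \<i> 1) = c * c + 1"
    by (simp add: algebra_simps sc_mult_left sc_mult_right sc_sc sc_minus_left sc_diff_right sc_add_right)
  then have "(a - sc z 1) * ((1 / Im z) *\<^sub>R ((c + sc \<i> 1) * v)) = 1"
    using z v by (simp add: az mult.assoc[symmetric])
  moreover have "(1 / Im z) *\<^sub>R ((c + sc \<i> 1) * v) \<in> C"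
    using c v by (intro C_scaleR C_mult C_add C_sc) (auto intro: S_C K_S)
  ultimately show ?thesis by blast
qed

section \<open>Characters\<close>

abbreviation \<Sigma> :: "('a \<Rightarrow> complex) set" where "\<Sigma> \<equiv> characters sc C"

lemma ch_add: "l \<in> \<Sigma> \<Longrightarrow> x \<in> C \<Longrightarrow> y \<in> C \<Longrightarrow> l (x + y) = l x + l y"
  and ch_mult: "l \<in> \<Sigma> \<Longrightarrow> x \<in> C \<Longrightarrow> y \<in> C \<Longrightarrow> l (x * y) = l x * l y"
  and ch_sc: "l \<in> \<Sigma> \<Longrightarrow> x \<in> C \<Longrightarrow> l (sc z x) = z * l x"
  and ch_1: "l \<in> \<Sigma> \<Longrightarrow> l 1 = 1"
  by (auto simp: characters_def)

lemma ch_scaleR: "l \<in> \<Sigma> \<Longrightarrow> x \<in> C \<Longrightarrow> l (r *\<^sub>R x) = of_real r * l x"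
  using ch_sc[of l x "of_real r"] by (simp add: sc_of_real)

lemma ch_0: "l \<in> \<Sigma> \<Longrightarrow> l 0 = 0"
  using ch_scaleR[of l 1 0] by simp

lemma ch_diff: "l \<in> \<Sigma> \<Longrightarrow> x \<in> C \<Longrightarrow> y \<in> C \<Longrightarrow> l (x - y) = l x - l y"
  using ch_add[of l x "- 1 *\<^sub>R y"] ch_scaleR[of l y "- 1"] C_minus[of y] by simp

lemma C_sum: "(\<And>i. i \<in> I \<Longrightarrow> f i \<in> C) \<Longrightarrow> (\<Sum>i\<in>I. f i) \<in> C"
  by (induction I rule: infinite_finite_induct) (auto simp: C_add)

lemma ch_sum: "l \<in> \<Sigma> \<Longrightarrow> (\<And>i. i \<in> I \<Longrightarrow> f i \<in> C) \<Longrightarrow> l (\<Sum>i\<in>I. f i) = (\<Sum>i\<in>I. l (f i))"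
proof (induction I rule: infinite_finite_induct)
  case (insert i I)
  have "(\<Sum>i\<in>I. f i) \<in> C" using insert.prems(2) by (intro C_sum) auto
  then show ?case using insert by (simp add: ch_add)
qed (auto simp: ch_0)

lemma ch_invertible: "l \<in> \<Sigma> \<Longrightarrow> x \<in> C \<Longrightarrow> u \<in> C \<Longrightarrow> x * u = 1 \<Longrightarrow> l x \<noteq> 0"
  using ch_mult[of l x u] ch_1[of l] by auto

text \<open>Otherwise \<open>a - l a\<close> would be invertible in \<open>C\<close> and yet
  annihilated by \<open>l\<close>.\<close>

lemma ch_real:
  assumes l: "l \<in> \<Sigma>" and a: "a \<in> S"
  shows "l a = of_real (Re (l a))"
proof -
  have "Im (l a) = 0"
  proof (rule ccontr)
    assume "Im (l a) \<noteq> 0"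
    then obtain u where "u \<in> C" "(a - sc (l a) 1) * u = 1"
      using nonreal_shift_inverse[OF a] by blast
    moreover have "a - sc (l a) 1 \<in> C" by (intro C_diff C_sc C_1 S_C[OF a])
    ultimately have "l (a - sc (l a) 1) \<noteq> 0" using ch_invertible[OF l] by blast
    then show False using S_C[OF a] by (simp add: ch_diff[OF l] ch_sc[OF l] ch_1[OF l] C_sc)
  qed
  then show ?thesis by (simp add: complex_eq_iff)
qed

lemma ch_K:
  assumes l: "l \<in> \<Sigma>" and a: "a \<in> K"
  shows "0 \<le> Re (l a)"
proof (rule ccontr)
  assume "\<not> 0 \<le> Re (l a)"
  then obtain u where "u \<in> K" "(a + (- Re (l a)) *\<^sub>R 1) * u = 1"
    using K_shift_inverse[OF a, of "- Re (l a)"] by auto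
  moreover have aC: "a \<in> C" using a by (intro S_C K_S)
  ultimately have "l (a + (- Re (l a)) *\<^sub>R 1) \<noteq> 0"
    by (intro ch_invertible[OF l] C_add C_scaleR C_1) (auto intro: S_C K_S)
  then show False using aC ch_real[OF l K_S[OF a]]
    by (simp add: ch_diff[OF l] ch_scaleR[OF l] ch_1[OF l] C_scaleR)
qed

section \<open>Real and imaginary parts; characters respect the involution and the norm\<close>

definition re :: "'a \<Rightarrow> 'a" where "re x = (1/2) *\<^sub>R (x + st x)"
definition im :: "'a \<Rightarrow> 'a" where "im x = sc (- \<i>) ((1/2) *\<^sub>R (x - st x))"

lemma re_S: "x \<in> C \<Longrightarrow> re x \<in> S"
  by (rule S_I) (auto simp: re_def C_scaleR C_add C_st st_scaleR st_add st_st add.commute)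

lemma im_S: "x \<in> C \<Longrightarrow> im x \<in> S"
  by (rule S_I)
    (auto simp: im_def C_scaleR C_diff C_st C_sc st_sc st_scaleR st_diff st_st sc_minus_left
      sc_diff_right sc_scaleR algebra_simps)

lemma re_im: "x = re x + sc \<i> (im x)"
proof -
  have "sc \<i> (im x) = (1/2) *\<^sub>R (x - st x)" by (simp add: im_def sc_sc)
  moreover have "re x + (1/2) *\<^sub>R (x - st x) = (1/2) *\<^sub>R (x + x)"
    by (simp add: re_def flip: scaleR_add_right)
  ultimately show ?thesis by (simp flip: scaleR_2)
qed

lemma re_im_unique:
  assumes "a \<in> S" "b \<in> S"
  shows "re (a + sc \<i> b) = a" "im (a + sc \<i> b) = b"
proof -
  have st: "st (a + sc \<i> b) = a - sc \<i> b"
    using assms by (simp add: st_add st_sc S_st sc_minus_left)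
  show "re (a + sc \<i> b) = a" unfolding re_def st by (simp flip: scaleR_2)
  have "a + sc \<i> b - (a - sc \<i> b) = 2 *\<^sub>R sc \<i> b" by (simp add: scaleR_2)
  then show "im (a + sc \<i> b) = b" unfolding im_def st by (simp add: sc_sc)
qed

lemma ch_st:
  assumes l: "l \<in> \<Sigma>" and x: "x \<in> C"
  shows "l (st x) = cnj (l x)"
proof -
  note S = re_S[OF x] im_S[OF x]
  have "st x = re x + sc (- \<i>) (im x)"
    by (subst re_im[of x]) (simp add: st_add st_sc S_st[OF S(1)] S_st[OF S(2)])
  moreover have "l (re x + sc (- \<i>) (im x)) = l (re x) + - \<i> * l (im x)"
    using S by (simp add: ch_add[OF l] ch_sc[OF l] S_C C_sc)
  moreover have "l x = l (re x) + \<i> * l (im x)"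
    by (subst re_im[of x]) (use S in \<open>simp add: ch_add[OF l] ch_sc[OF l] S_C C_sc\<close>)
  moreover have "cnj (l (re x)) = l (re x)" "cnj (l (im x)) = l (im x)"
    using ch_real[OF l S(1)] ch_real[OF l S(2)] by (metis complex_cnj_complex_of_real)+
  ultimately show ?thesis by simp
qed

lemma st_mult_S: "x \<in> C \<Longrightarrow> st x * x \<in> S"
  by (auto intro!: S_I C_mult C_st simp: st_mult st_st)

lemma ch_st_mult:
  assumes "l \<in> \<Sigma>" "x \<in> C"
  shows "l (st x * x) = of_real ((cmod (l x))\<^sup>2)"
proof -
  have "l (st x * x) = l x * cnj (l x)"
    using assms by (simp add: ch_mult C_st ch_st mult.commute)
  then show ?thesis by (simp only: complex_norm_square)
qed

text \<open>Automatic continuity, from positivity of \<open>(norm x)^2 - st x * x\<close>. It also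
  confines the spectrum to a product of discs.\<close>

lemma ch_norm:
  assumes l: "l \<in> \<Sigma>" and x: "x \<in> C"
  shows "cmod (l x) \<le> norm x"
proof -
  have "(norm x)\<^sup>2 *\<^sub>R 1 - st x * x \<in> K"
    by (intro K_order_unit st_mult_S x) (simp add: norm_st_mult)
  from ch_K[OF l this] have "(cmod (l x))\<^sup>2 \<le> (norm x)\<^sup>2"
    using S_C[OF st_mult_S[OF x]]
    by (simp add: ch_diff[OF l] ch_scaleR[OF l] ch_1[OF l] C_scaleR ch_st_mult[OF l x])
  then show ?thesis by (rule power2_le_imp_le) simp
qed

text \<open>Invertibility in the ambient algebra is enough: the inverses of the shifts of $a$ off the
real axis lie in $C$ and stay bounded, so a character cannot vanish in the limit.\<close>

lemma ch_cpositive: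
  assumes l: "l \<in> \<Sigma>" and a: "a \<in> S" and pos: "cpositive sc st a"
  shows "0 \<le> Re (l a)"
proof (rule ccontr)
  assume neg: "\<not> 0 \<le> Re (l a)"
  define r where "r = Re (l a)"
  have "complex_of_real r \<notin> {complex_of_real r | r. r \<ge> 0}" using neg by (auto simp: r_def)
  then have "alg_invertible (a - sc (complex_of_real r) 1)"
    using pos unfolding cpositive_def by blast
  then obtain y where y: "y * (a - r *\<^sub>R 1) = 1"
    by (auto simp: alg_invertible_def sc_of_real)
  define n where "n = norm y + 1"
  have n: "n > 0" "norm y = n - 1" by (simp_all add: n_def add_nonneg_pos)
  \<comment> \<open>Small enough that \<open>t * norm y \<le> 1/2\<close>, which gives
    \<open>norm u \<le> 2 * norm y\<close>, whereas \<open>l u\<close> has modulus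
    \<open>1 / t = 2 * norm y + 2\<close>.\<close>
  define t where "t = 1 / (2 * n)"
  have t: "t > 0" "t * norm y \<le> 1/2" "1 / t = 2 * n"
    using n(1) unfolding n(2) by (auto simp: t_def divide_simps)
  define z where "z = Complex r t"
  obtain u where u: "u \<in> C" "(a - sc z 1) * u = 1"
    using nonreal_shift_inverse[OF a, of z] t by (auto simp: z_def)
  have az: "a - sc z 1 = (a - r *\<^sub>R 1) - t *\<^sub>R sc \<i> 1"
    by (simp add: z_def sc_Complex algebra_simps)
  have "y = y * ((a - sc z 1) * u)" using u by simp
  also have "\<dots> = (y * (a - r *\<^sub>R 1)) * u - t *\<^sub>R sc \<i> (y * u)"
    unfolding az by (simp add: left_diff_distrib right_diff_distrib mult.assoc sc_mult_left sc_mult_right)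
  finally have "y = u - t *\<^sub>R sc \<i> (y * u)" using y by simp
  then have "u = y + t *\<^sub>R sc \<i> (y * u)" by (metis diff_add_cancel)
  then have "norm u \<le> norm y + t * norm (y * u)"
    using norm_triangle_ineq[of y "t *\<^sub>R sc \<i> (y * u)"] t by (simp add: norm_sc)
  also have "t * norm (y * u) \<le> t * (norm y * norm u)"
    using t by (intro mult_left_mono norm_mult_ineq) auto
  also have "\<dots> \<le> (1/2) * norm u"
    using mult_right_mono[OF t(2), of "norm u"] by (simp add: mult.assoc)
  finally have "norm u \<le> 2 * norm y" by simp
  then have lu: "cmod (l u) \<le> 2 * norm y" using ch_norm[OF l u(1)] by linarith
  have "l (a - sc z 1) = - (of_real t * \<i>)"
    using S_C[OF a] ch_real[OF l a]
    by (simp add: ch_diff[OF l] ch_sc[OF l] ch_1[OF l] C_sc z_def r_def complex_eq_iff)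
  moreover have "l (a - sc z 1) * l u = 1"
    using u S_C[OF a] ch_mult[OF l, of "a - sc z 1" u] by (simp add: C_diff C_sc ch_1[OF l])
  ultimately have "cmod (- (of_real t * \<i>)) * cmod (l u) = 1" by (metis norm_mult norm_one)
  then have "t * cmod (l u) = 1" using t by (simp add: norm_mult)
  then have "cmod (l u) = 1 / t" using t by (simp add: field_simps)
  then show False using lu t n by simp
qed

section \<open>Existence of characters\<close>

text \<open>Preorderings in real algebra must contain all squares; containing \<open>K\<close>
  ensures this by \<open>K_square\<close> and also supplies the order unit that makes
  \<open>Q\<close> Archimedean.\<close>

definition preordering :: "'a set \<Rightarrow> bool" where
  "preordering Q \<longleftrightarrow> K \<subseteq> Q \<and> Q \<subseteq> S \<and> (\<forall>a\<in>Q. \<forall>b\<in>Q. a + b \<in> Q \<and> a * b \<in> Q) \<and> - 1 \<notin> Q"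

lemma preordering_K: "preordering K"
  using K_S K_add K_mult minus_one_K by (auto simp: preordering_def)

text \<open>In a product the term \<open>(a * q) * (a * q')\<close> is absorbed because
  \<open>a * a\<close> lies in the cone, so \<open>- 1\<close> is the only obstruction to adjoining
  \<open>a\<close>.\<close>

lemma preordering_adjoin:
  assumes Q: "preordering Q" and a: "a \<in> S"
    and proper: "\<And>p q. p \<in> Q \<Longrightarrow> q \<in> Q \<Longrightarrow> p + a * q \<noteq> - 1"
  shows "preordering {p + a * q | p q. p \<in> Q \<and> q \<in> Q}"
proof -
  define T where "T = {p + a * q | p q. p \<in> Q \<and> q \<in> Q}"
  have QS: "\<And>q. q \<in> Q \<Longrightarrow> q \<in> S" and Qa: "\<And>p q. p \<in> Q \<Longrightarrow> q \<in> Q \<Longrightarrow> p + q \<in> Q"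
    and Qm: "\<And>p q. p \<in> Q \<Longrightarrow> q \<in> Q \<Longrightarrow> p * q \<in> Q" and KQ: "\<And>q. q \<in> K \<Longrightarrow> q \<in> Q"
    using Q by (auto simp: preordering_def)
  have "x + y \<in> T \<and> x * y \<in> T" if xy: "x \<in> T" "y \<in> T" for x y
  proof -
    obtain p q p' q' where x: "x = p + a * q" and y: "y = p' + a * q'"
      and q: "p \<in> Q" "q \<in> Q" "p' \<in> Q" "q' \<in> Q"
      using xy unfolding T_def by blast
    have "x + y = (p + p') + a * (q + q')" by (simp add: x y algebra_simps)
    moreover have "x * y = (p * p' + (a * a) * (q * q')) + a * (p * q' + q * p')"
    proof -
      have "p * (a * q') = a * (p * q')" "(a * q) * (a * q') = (a * a) * (q * q')"
        using S_comm[OF QS[OF q(1)] a] S_comm[OF QS[OF q(2)] a] by (metis mult.assoc)+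
      then show ?thesis by (simp add: x y algebra_simps)
    qed
    moreover have "p + p' \<in> Q" "q + q' \<in> Q" "p * p' + (a * a) * (q * q') \<in> Q" "p * q' + q * p' \<in> Q"
      using q KQ[OF K_square[OF a]] by (auto intro!: Qa Qm)
    ultimately show ?thesis unfolding T_def by blast
  qed
  moreover have "T \<subseteq> S" using QS a by (auto simp: T_def intro!: S_add S_mult)
  moreover have "K \<subseteq> T"
  proof
    fix k assume "k \<in> K"
    then have "k = k + a * 0 \<and> k \<in> Q \<and> 0 \<in> Q" by (auto intro: KQ)
    then show "k \<in> T" unfolding T_def by blast
  qed
  moreover have "- 1 \<notin> T" using proper by (auto simp: T_def) metis
  ultimately have "preordering T" unfolding preordering_def by blast
  then show ?thesis by (simp add: T_def)
qed

lemma maximal_preordering_exists: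
  assumes "preordering Q0"
  obtains Q where "preordering Q" "Q0 \<subseteq> Q" "\<And>Q'. preordering Q' \<Longrightarrow> Q \<subseteq> Q' \<Longrightarrow> Q' = Q"
proof -
  define A where "A = {Q. preordering Q \<and> Q0 \<subseteq> Q}"
  have "\<exists>M\<in>A. \<forall>X\<in>A. M \<subseteq> X \<longrightarrow> X = M"
  proof (rule subset_Zorn_nonempty)
    show "A \<noteq> {}" using assms by (auto simp: A_def)
    fix F assume F: "F \<noteq> {}" "subset.chain A F"
    have FA: "\<And>Q. Q \<in> F \<Longrightarrow> preordering Q \<and> Q0 \<subseteq> Q"
      using F by (auto simp: subset_chain_def A_def)
    have "a + b \<in> \<Union>F \<and> a * b \<in> \<Union>F" if ab: "a \<in> \<Union>F" "b \<in> \<Union>F" for a b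
    proof -
      obtain P Q where PQ: "P \<in> F" "a \<in> P" "Q \<in> F" "b \<in> Q" using ab by blast
      then have "P \<subseteq> Q \<or> Q \<subseteq> P" using F by (auto simp: subset_chain_def)
      then obtain R where "R \<in> F" "a \<in> R" "b \<in> R" using PQ by blast
      then show ?thesis using FA[of R] unfolding preordering_def by blast
    qed
    moreover have "K \<subseteq> \<Union>F" "Q0 \<subseteq> \<Union>F" using F FA unfolding preordering_def by blast+
    moreover have "\<Union>F \<subseteq> S" "- 1 \<notin> \<Union>F" using FA unfolding preordering_def by blast+
    ultimately show "\<Union>F \<in> A" unfolding A_def preordering_def by blast
  qed
  then obtain Q where "Q \<in> A" "\<forall>X\<in>A. Q \<subseteq> X \<longrightarrow> X = Q" by blast
  then show thesis using that[of Q] by (auto simp: A_def)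
qed

end

section \<open>Maximal preorderings and their standard part\<close>

locale maximal_preordering = csub sc st C
  for sc :: "complex \<Rightarrow> 'a::{real_normed_algebra_1,banach} \<Rightarrow> 'a" and st :: "'a \<Rightarrow> 'a" and C +
  fixes Q :: "'a set"
  assumes preordering: "preordering Q"
    and maximal: "\<And>Q'. preordering Q' \<Longrightarrow> Q \<subseteq> Q' \<Longrightarrow> Q' = Q"
begin

lemma Q_S: "q \<in> Q \<Longrightarrow> q \<in> S"
  and Q_add: "p \<in> Q \<Longrightarrow> q \<in> Q \<Longrightarrow> p + q \<in> Q"
  and Q_mult: "p \<in> Q \<Longrightarrow> q \<in> Q \<Longrightarrow> p * q \<in> Q"
  and K_Q: "q \<in> K \<Longrightarrow> q \<in> Q"
  and minus_one_Q: "- 1 \<notin> Q"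
  using preordering by (auto simp: preordering_def)

lemma Q_scaleR: "q \<in> Q \<Longrightarrow> r \<ge> 0 \<Longrightarrow> r *\<^sub>R q \<in> Q"
  using Q_mult[OF K_Q[OF K_scalar[of r]], of q] by simp

lemma Q_scalar: "r *\<^sub>R 1 \<in> Q \<longleftrightarrow> r \<ge> 0"
proof
  assume r: "r *\<^sub>R 1 \<in> Q"
  show "r \<ge> 0"
  proof (rule ccontr)
    assume "\<not> r \<ge> 0"
    then show False using Q_scaleR[OF r, of "1 / - r"] minus_one_Q by simp
  qed
qed (auto intro: K_Q K_scalar)

text \<open>If neither sign of \<open>a\<close> could be adjoined, then
  \<open>1 + p = - (a * q)\<close> and \<open>1 + p' = a * q'\<close> with all four elements in
  \<open>Q\<close>. Multiplying these exhibits \<open>- 1\<close> as the sum of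
  \<open>p + p' + p * p'\<close> and \<open>(a * a) * (q * q')\<close>, an element of
  \<open>Q\<close>.\<close>

lemma Q_total:
  assumes a: "a \<in> S"
  shows "a \<in> Q \<or> - a \<in> Q"
proof -
  have ext: "\<exists>p\<in>Q. \<exists>q\<in>Q. p + b * q = - 1" if b: "b \<in> S" "b \<notin> Q" for b
  proof (rule ccontr)
    assume "\<not> ?thesis"
    then have pre: "preordering {p + b * q | p q. p \<in> Q \<and> q \<in> Q}"
      using preordering_adjoin[OF preordering b(1)] by blast
    have "Q \<subseteq> {p + b * q | p q. p \<in> Q \<and> q \<in> Q}"
    proof
      fix p assume "p \<in> Q"
      then have "p = p + b * 0 \<and> p \<in> Q \<and> 0 \<in> Q" by (auto intro: K_Q)
      then show "p \<in> {p + b * q | p q. p \<in> Q \<and> q \<in> Q}" by blast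
    qed
    from maximal[OF pre this] have eq: "{p + b * q | p q. p \<in> Q \<and> q \<in> Q} = Q" .
    have "b = 0 + b * 1 \<and> 0 \<in> Q \<and> 1 \<in> Q" by (auto intro: K_Q)
    then have "b \<in> {p + b * q | p q. p \<in> Q \<and> q \<in> Q}" by blast
    then show False using eq b by simp
  qed
  show ?thesis
  proof (rule ccontr)
    assume "\<not> ?thesis"
    then obtain p q p' q' where q: "p \<in> Q" "q \<in> Q" "p' \<in> Q" "q' \<in> Q"
      and eq: "p + a * q = - 1" "p' + (- a) * q' = - 1"
      using ext[OF a] ext[OF S_minus[OF a]] by blast
    have "p = - 1 - a * q" "p' = - 1 - (- a) * q'"
      using eq by (simp_all only: eq_diff_eq)
    then have one: "1 + p = - (a * q)" "1 + p' = a * q'" by simp_all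
    define s where "s = p + p' + p * p'"
    have "1 + s = (1 + p) * (1 + p')" by (simp add: s_def algebra_simps)
    also have "\<dots> = - ((a * q) * (a * q'))" by (simp add: one)
    also have "(a * q) * (a * q') = (a * a) * (q * q')"
      using S_comm[OF Q_S[OF q(2)] a] by (metis mult.assoc)
    finally have "s = - ((a * a) * (q * q')) - 1" by (metis add_diff_cancel_left')
    then have "p + p' + p * p' + (a * a) * (q * q') = - 1" by (simp add: s_def)
    moreover have "p + p' + p * p' + (a * a) * (q * q') \<in> Q"
      using q K_Q[OF K_square[OF a]] by (auto intro!: Q_add Q_mult)
    ultimately show False using minus_one_Q by simp
  qed
qed

text \<open>The kernel of the future standard part: an ideal of \<open>S\<close> whose only scalar
  is 0.\<close>

definition infinitesimal :: "'a \<Rightarrow> bool" where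
  "infinitesimal x \<longleftrightarrow> x \<in> S \<and> (\<forall>e>0. e *\<^sub>R 1 + x \<in> Q \<and> e *\<^sub>R 1 - x \<in> Q)"

lemma infinitesimal_scalar: "infinitesimal (r *\<^sub>R 1) \<longleftrightarrow> r = 0"
proof
  assume inf: "infinitesimal (r *\<^sub>R 1)"
  show "r = 0"
  proof (rule ccontr)
    assume "r \<noteq> 0"
    then have "(\<bar>r\<bar>/2 + r) *\<^sub>R 1 \<in> Q \<and> (\<bar>r\<bar>/2 - r) *\<^sub>R 1 \<in> Q"
      using inf unfolding infinitesimal_def scaleR_add_left scaleR_diff_left by auto
    then show False using \<open>r \<noteq> 0\<close> unfolding Q_scalar by auto
  qed
qed (auto simp: infinitesimal_def Q_scalar)

lemma infinitesimal_add:
  assumes "infinitesimal x" "infinitesimal y"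
  shows "infinitesimal (x + y)"
  unfolding infinitesimal_def
proof (intro conjI allI impI)
  show "x + y \<in> S" using assms by (auto simp: infinitesimal_def S_add)
  fix e :: real assume "e > 0"
  then have "((e/2) *\<^sub>R 1 + x) + ((e/2) *\<^sub>R 1 + y) \<in> Q" "((e/2) *\<^sub>R 1 - x) + ((e/2) *\<^sub>R 1 - y) \<in> Q"
    using assms unfolding infinitesimal_def by (meson Q_add half_gt_zero)+
  moreover have "(e/2) *\<^sub>R (1::'a) + (e/2) *\<^sub>R 1 = e *\<^sub>R 1" by (simp flip: scaleR_add_left)
  then have "((e/2) *\<^sub>R 1 + x) + ((e/2) *\<^sub>R 1 + y) = e *\<^sub>R 1 + (x + y)"
    "((e/2) *\<^sub>R 1 - x) + ((e/2) *\<^sub>R 1 - y) = e *\<^sub>R 1 - (x + y)"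
    by (simp_all add: algebra_simps)
  ultimately show "e *\<^sub>R 1 + (x + y) \<in> Q" "e *\<^sub>R 1 - (x + y) \<in> Q" by simp_all
qed

text \<open>Polarization: $(e+x)(n+b) + (e-x)(n-b) = 2(en + xb)$.\<close>

lemma infinitesimal_mult:
  assumes x: "infinitesimal x" and b: "b \<in> S"
  shows "infinitesimal (x * b)"
proof -
  \<comment> \<open>The summand 1 keeps \<open>n\<close> positive for the quotient
    \<open>e / n\<close>; since \<open>b\<close> and \<open>- b\<close> have the same norm,
    \<open>key\<close> serves both signs.\<close>
  define n where "n = norm b + 1"
  have n: "n > 0" by (simp add: n_def add_nonneg_pos)
  have xS: "x \<in> S" using x by (simp add: infinitesimal_def)
  have key: "e *\<^sub>R 1 + x * c \<in> Q" if "e > 0" and c: "c \<in> S" "norm c \<le> n" for e c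
  proof -
    have A: "(e/n) *\<^sub>R 1 + x \<in> Q" "(e/n) *\<^sub>R 1 - x \<in> Q"
      using x n that by (auto simp: infinitesimal_def)
    have B: "n *\<^sub>R 1 + c \<in> Q" "n *\<^sub>R 1 - c \<in> Q" using K_order_unit[OF c] by (auto intro: K_Q)
    have "(1/2) *\<^sub>R (((e/n) *\<^sub>R 1 + x) * (n *\<^sub>R 1 + c) + ((e/n) *\<^sub>R 1 - x) * (n *\<^sub>R 1 - c)) \<in> Q"
      by (rule Q_scaleR[OF Q_add[OF Q_mult[OF A(1) B(1)] Q_mult[OF A(2) B(2)]]]) simp
    moreover have "((e/n) *\<^sub>R 1 + x) * (n *\<^sub>R 1 + c) + ((e/n) *\<^sub>R 1 - x) * (n *\<^sub>R 1 - c)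
        = (e *\<^sub>R 1 + x * c) + (e *\<^sub>R 1 + x * c)"
      using n by (simp add: algebra_simps)
    ultimately show ?thesis by (simp flip: scaleR_2)
  qed
  have "e *\<^sub>R 1 + x * b \<in> Q \<and> e *\<^sub>R 1 - x * b \<in> Q" if "e > 0" for e
    using key[OF that b] key[OF that S_minus[OF b]] by (simp add: n_def)
  then show ?thesis using S_mult[OF xS b] by (simp add: infinitesimal_def)
qed

text \<open>A Dedekind cut: the infimum of the scalars above \<open>a\<close>. The order unit bounds
  this set, and totality turns the failure of \<open>r - e\<close> to lie above \<open>a\<close>
  into \<open>r - e\<close> lying below \<open>a\<close>.\<close>

lemma standard_part_exists:
  assumes a: "a \<in> S"
  shows "\<exists>r. infinitesimal (a - r *\<^sub>R 1)"
proof -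
  define R where "R = {r. r *\<^sub>R 1 - a \<in> Q}"
  have ne: "norm a \<in> R" using K_order_unit(1)[OF a order_refl] by (simp add: R_def K_Q)
  have lower: "- norm a \<le> r" if "r \<in> R" for r
  proof -
    have "(norm a *\<^sub>R 1 + a) + (r *\<^sub>R 1 - a) \<in> Q"
      using that by (intro Q_add K_Q[OF K_order_unit(2)[OF a order_refl]]) (simp add: R_def)
    then have "(norm a + r) *\<^sub>R 1 \<in> Q" by (simp add: scaleR_add_left)
    then show ?thesis unfolding Q_scalar by simp
  qed
  then have bdd: "bdd_below R" by (rule bdd_belowI)
  define r where "r = Inf R"
  have "e *\<^sub>R 1 + (a - r *\<^sub>R 1) \<in> Q \<and> e *\<^sub>R 1 - (a - r *\<^sub>R 1) \<in> Q" if e: "e > 0" for e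
  proof
    have "r - e \<notin> R" using cInf_lower[OF _ bdd, of "r - e"] e by (auto simp: r_def)
    then have "- ((r - e) *\<^sub>R 1 - a) \<in> Q"
      using Q_total[of "(r - e) *\<^sub>R 1 - a"] a by (auto simp: R_def S_diff S_scaleR)
    then show "e *\<^sub>R 1 + (a - r *\<^sub>R 1) \<in> Q" by (simp add: algebra_simps)
    obtain s where s: "s \<in> R" "s < r + e" using cInf_lessD[of R "r + e"] ne e by (auto simp: r_def)
    have "(s *\<^sub>R 1 - a) + (r + e - s) *\<^sub>R 1 \<in> Q"
      using s by (intro Q_add K_Q[OF K_scalar]) (auto simp: R_def)
    then show "e *\<^sub>R 1 - (a - r *\<^sub>R 1) \<in> Q" by (simp add: algebra_simps)
  qed
  then show ?thesis using a by (auto simp: infinitesimal_def intro!: S_diff S_scaleR exI[of _ r])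
qed

lemma infinitesimal_minus: "infinitesimal x \<Longrightarrow> infinitesimal (- x)"
  by (simp add: infinitesimal_def S_minus)

definition \<phi> :: "'a \<Rightarrow> real" where "\<phi> a = (THE r. infinitesimal (a - r *\<^sub>R 1))"

lemma \<phi>_eq:
  assumes "infinitesimal (a - r *\<^sub>R 1)"
  shows "\<phi> a = r"
  unfolding \<phi>_def
proof (rule the_equality)
  show "infinitesimal (a - r *\<^sub>R 1)" by (rule assms)
  fix s assume "infinitesimal (a - s *\<^sub>R 1)"
  from infinitesimal_add[OF assms infinitesimal_minus[OF this]]
  have "infinitesimal ((s - r) *\<^sub>R 1)" by (simp add: algebra_simps)
  then show "s = r" by (simp add: infinitesimal_scalar)
qed

lemma \<phi>: "a \<in> S \<Longrightarrow> infinitesimal (a - \<phi> a *\<^sub>R 1)"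
  using standard_part_exists[of a] \<phi>_eq by metis

lemma \<phi>_add:
  assumes "a \<in> S" "b \<in> S"
  shows "\<phi> (a + b) = \<phi> a + \<phi> b"
proof (rule \<phi>_eq)
  show "infinitesimal (a + b - (\<phi> a + \<phi> b) *\<^sub>R 1)"
    using infinitesimal_add[OF \<phi>[OF assms(1)] \<phi>[OF assms(2)]] by (simp add: algebra_simps)
qed

lemma \<phi>_mult:
  assumes "a \<in> S" "b \<in> S"
  shows "\<phi> (a * b) = \<phi> a * \<phi> b"
proof (rule \<phi>_eq)
  \<comment> \<open>The product error is split into two terms, each a multiple of an
    infinitesimal.\<close>
  have "infinitesimal ((a - \<phi> a *\<^sub>R 1) * b + (b - \<phi> b *\<^sub>R 1) * (\<phi> a *\<^sub>R 1))"
    by (intro infinitesimal_add infinitesimal_mult \<phi> assms S_scaleR S_1)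
  moreover have "(a - \<phi> a *\<^sub>R 1) * b + (b - \<phi> b *\<^sub>R 1) * (\<phi> a *\<^sub>R 1) = a * b - (\<phi> a * \<phi> b) *\<^sub>R 1"
    by (simp add: algebra_simps)
  ultimately show "infinitesimal (a * b - (\<phi> a * \<phi> b) *\<^sub>R 1)" by simp
qed

lemma \<phi>_scalar: "\<phi> (r *\<^sub>R 1) = r"
  by (rule \<phi>_eq) (use infinitesimal_scalar[of 0] in simp)

lemma \<phi>_scaleR: "a \<in> S \<Longrightarrow> \<phi> (r *\<^sub>R a) = r * \<phi> a"
  using \<phi>_mult[of "r *\<^sub>R 1" a] by (simp add: \<phi>_scalar S_scaleR)

text \<open>If \<open>\<phi> a\<close> were negative, half of its size would dominate the
  infinitesimal part; adding \<open>a\<close> then leaves the negative scalar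
  \<open>\<phi> a / 2\<close> in \<open>Q\<close>.\<close>

lemma \<phi>_nonneg:
  assumes a: "a \<in> Q"
  shows "0 \<le> \<phi> a"
proof (rule ccontr)
  assume neg: "\<not> 0 \<le> \<phi> a"
  then have "(- \<phi> a / 2) *\<^sub>R 1 - (a - \<phi> a *\<^sub>R 1) \<in> Q"
    using \<phi>[OF Q_S[OF a]] unfolding infinitesimal_def by (metis linorder_not_le neg_0_less_iff_less half_gt_zero)
  then have "(- \<phi> a / 2) *\<^sub>R 1 - (a - \<phi> a *\<^sub>R 1) + a \<in> Q" using a by (rule Q_add)
  moreover have "(- \<phi> a / 2) *\<^sub>R 1 - (a - \<phi> a *\<^sub>R 1) + a = (- \<phi> a / 2) *\<^sub>R 1 + \<phi> a *\<^sub>R 1"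
    by simp
  ultimately have "(- \<phi> a / 2 + \<phi> a) *\<^sub>R 1 \<in> Q" by (simp only: scaleR_add_left)
  then show False using neg unfolding Q_scalar by simp
qed

text \<open>The complex-linear extension of \<open>\<phi>\<close>, restricted because
  \<open>characters\<close> consists of extensional functions.\<close>

definition \<kappa> :: "'a \<Rightarrow> complex" where
  "\<kappa> = restrict (\<lambda>x. Complex (\<phi> (re x)) (\<phi> (im x))) C"

lemma \<kappa>_eq: "a \<in> S \<Longrightarrow> b \<in> S \<Longrightarrow> \<kappa> (a + sc \<i> b) = Complex (\<phi> a) (\<phi> b)"
  by (simp add: \<kappa>_def re_im_unique C_add C_sc S_C)

lemma \<kappa>_S: "a \<in> S \<Longrightarrow> \<kappa> a = of_real (\<phi> a)"
  using \<kappa>_eq[of a 0] \<phi>_scalar[of 0] by (simp add: complex_of_real_def)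

lemma \<kappa>_character: "\<kappa> \<in> \<Sigma>"
proof -
  have "\<kappa> (x + y) = \<kappa> x + \<kappa> y \<and> \<kappa> (x * y) = \<kappa> x * \<kappa> y" if xy: "x \<in> C" "y \<in> C" for x y
  proof
    define a b c d where abcd: "a = re x" "b = im x" "c = re y" "d = im y"
    have S: "a \<in> S" "b \<in> S" "c \<in> S" "d \<in> S" and x: "x = a + sc \<i> b" and y: "y = c + sc \<i> d"
      using xy re_S im_S re_im[of x] re_im[of y] by (auto simp: abcd)
    have cx: "\<kappa> x = Complex (\<phi> a) (\<phi> b)" and cy: "\<kappa> y = Complex (\<phi> c) (\<phi> d)"
      using \<kappa>_eq S x y by simp_all
    have "x + y = (a + c) + sc \<i> (b + d)" by (simp add: x y sc_add_right)
    then show "\<kappa> (x + y) = \<kappa> x + \<kappa> y"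
      using \<kappa>_eq[of "a + c" "b + d"] S by (simp add: S_add cx cy \<phi>_add complex_eq_iff)
    have "x * y = (a * c + (- 1) *\<^sub>R (b * d)) + sc \<i> (a * d + b * c)"
      by (simp add: x y algebra_simps sc_add_right sc_mult_left sc_mult_right sc_sc sc_minus_left)
    then have "\<kappa> (x * y) = Complex (\<phi> (a * c + (- 1) *\<^sub>R (b * d))) (\<phi> (a * d + b * c))"
      using \<kappa>_eq S by (metis S_add S_mult S_scaleR)
    also have "\<phi> (a * c + (- 1) *\<^sub>R (b * d)) = \<phi> a * \<phi> c + (- 1) * (\<phi> b * \<phi> d)"
      using S by (simp only: \<phi>_add \<phi>_mult \<phi>_scaleR S_mult S_scaleR)
    also have "\<phi> (a * d + b * c) = \<phi> a * \<phi> d + \<phi> b * \<phi> c"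
      using S by (simp only: \<phi>_add \<phi>_mult S_mult)
    finally show "\<kappa> (x * y) = \<kappa> x * \<kappa> y" by (simp add: cx cy complex_eq_iff)
  qed
  moreover have "\<kappa> (sc z x) = z * \<kappa> x" if x: "x \<in> C" for z x
  proof -
    define a b where ab: "a = re x" "b = im x"
    have S: "a \<in> S" "b \<in> S" and x: "x = a + sc \<i> b"
      using x re_S im_S re_im[of x] by (auto simp: ab)
    have z: "sc z y = Re z *\<^sub>R y + sc \<i> (Im z *\<^sub>R y)" for y
      using sc_Complex[of "Re z" "Im z" y] by (simp add: sc_scaleR)
    have "sc z x = sc z a + sc \<i> (sc z b)" by (simp add: x sc_add_right sc_sc mult.commute)
    also have "\<dots> = (Re z *\<^sub>R a + (- Im z) *\<^sub>R b) + sc \<i> (Im z *\<^sub>R a + Re z *\<^sub>R b)"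
      unfolding z by (simp add: sc_add_right sc_scaleR sc_sc sc_minus_left algebra_simps)
    finally have "\<kappa> (sc z x) = Complex (\<phi> (Re z *\<^sub>R a + (- Im z) *\<^sub>R b)) (\<phi> (Im z *\<^sub>R a + Re z *\<^sub>R b))"
      using \<kappa>_eq S by (metis S_add S_scaleR)
    also have "\<phi> (Re z *\<^sub>R a + (- Im z) *\<^sub>R b) = Re z * \<phi> a + (- Im z) * \<phi> b"
      using S by (simp only: \<phi>_add \<phi>_scaleR S_scaleR)
    also have "\<phi> (Im z *\<^sub>R a + Re z *\<^sub>R b) = Im z * \<phi> a + Re z * \<phi> b"
      using S by (simp only: \<phi>_add \<phi>_scaleR S_scaleR)
    finally show ?thesis using \<kappa>_eq S x by (simp add: complex_eq_iff)
  qed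
  moreover have "\<kappa> 1 = 1" using \<kappa>_S[of 1] \<phi>_scalar[of 1] by simp
  moreover have "\<kappa> \<in> extensional C" by (simp add: \<kappa>_def)
  ultimately show ?thesis by (simp add: characters_def)
qed

end

context csub
begin

text \<open>Adjoin \<open>- a\<close> to the cone. If that produced \<open>- 1\<close>, then
  \<open>a * q = 1 + p\<close> would have an inverse \<open>u\<close> in the cone, so
  \<open>a = (a * a) * (q * u)\<close> would lie there too. The inequality is not strict because a
  standard part can vanish.\<close>

lemma character_exists:
  assumes a: "a \<in> S" "a \<notin> K"
  shows "\<exists>l\<in>\<Sigma>. Re (l a) \<le> 0"
proof -
  have pre: "preordering {p + - a * q | p q. p \<in> K \<and> q \<in> K}"
  proof (rule preordering_adjoin[OF preordering_K S_minus[OF a(1)]])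
    fix p q assume pq: "p \<in> K" "q \<in> K"
    show "p + - a * q \<noteq> - 1"
    proof
      assume eq: "p + - a * q = - 1"
      have "a * q = p - (p + - a * q)" by simp
      then have "a * q = p - (- 1)" unfolding eq .
      then have aq: "a * q = p + 1 *\<^sub>R 1" by simp
      obtain u where u: "u \<in> K" "(p + 1 *\<^sub>R 1) * u = 1" using K_shift_inverse[OF pq(1), of 1] by auto
      have "a * (q * u) = 1" using aq u by (metis mult.assoc)
      then have "a = (a * a) * (q * u)" by (simp add: mult.assoc)
      moreover have "(a * a) * (q * u) \<in> K" using pq u by (intro K_mult K_square a)
      ultimately show False using a by simp
    qed
  qed
  obtain Q where Q: "preordering Q" "{p + - a * q | p q. p \<in> K \<and> q \<in> K} \<subseteq> Q"
    "\<And>Q'. preordering Q' \<Longrightarrow> Q \<subseteq> Q' \<Longrightarrow> Q' = Q"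
    using maximal_preordering_exists[OF pre] by blast
  interpret maximal_preordering sc st C Q by unfold_locales (use Q in auto)
  have "- a = 0 + - a * 1 \<and> 0 \<in> K \<and> 1 \<in> K" by simp
  then have "- a \<in> Q" using Q(2) by blast
  then have "0 \<le> \<phi> ((- 1) *\<^sub>R a)" using \<phi>_nonneg by simp
  then have "\<phi> a \<le> 0" using \<phi>_scaleR[OF a(1), of "- 1"] by simp
  then show ?thesis using \<kappa>_character \<kappa>_S[OF a(1)] by (intro bexI[of _ \<kappa>]) simp_all
qed

section \<open>Positivity and positive parts\<close>

lemma K_iff:
  assumes a: "a \<in> S"
  shows "a \<in> K \<longleftrightarrow> (\<forall>l\<in>\<Sigma>. 0 \<le> Re (l a))"
proof
  assume "\<forall>l\<in>\<Sigma>. 0 \<le> Re (l a)"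
  \<comment> \<open>The shift makes positivity strict at every character, which is what contradicts
    \<open>character_exists\<close>; closedness of the cone then removes it.\<close>
  then have "0 < Re (l (a + e *\<^sub>R 1))" if "l \<in> \<Sigma>" "e > 0" for l e
    using that S_C[OF a] by (auto simp: ch_add ch_scaleR ch_1 C_scaleR add_nonneg_pos)
  then have "a + e *\<^sub>R 1 \<in> K" if "e > 0" for e
    using character_exists[of "a + e *\<^sub>R 1"] that a by (force simp: S_add S_scaleR)
  then show "a \<in> K" by (intro K_approx[OF a] bexI[of _ "a + _ *\<^sub>R 1"]) auto
qed (auto intro: ch_K)

lemma invertible_commI:
  assumes "x \<in> C" "u \<in> C" "x * u = 1"
  shows "alg_invertible x"
  using assms C_comm[of x u] by (auto simp: alg_invertible_def)

lemma K_cpositive: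
  assumes a: "a \<in> K"
  shows "cpositive sc st a"
  unfolding cpositive_def
proof (intro conjI allI impI)
  show "st a = a" using a by (intro S_st K_S)
  note aC = S_C[OF K_S[OF a]]
  fix z assume z: "z \<notin> {complex_of_real r |r. 0 \<le> r}"
  have xC: "a - sc z 1 \<in> C" by (intro C_diff C_sc C_1 aC)
  show "alg_invertible (a - sc z 1)"
  proof (cases "Im z = 0")
    case True
    then have zr: "z = of_real (Re z)" by (simp add: complex_eq_iff)
    then have "Re z < 0" using z by (metis (mono_tags, lifting) linorder_not_le mem_Collect_eq)
    then obtain u where "u \<in> K" "(a + (- Re z) *\<^sub>R 1) * u = 1"
      using K_shift_inverse[OF a, of "- Re z"] by auto
    moreover have "sc z 1 = Re z *\<^sub>R 1" using sc_of_real[of "Re z" 1] zr by simp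
    ultimately show ?thesis using invertible_commI[OF xC, of u] by (simp add: S_C K_S)
  next
    case False
    then show ?thesis using nonreal_shift_inverse[OF K_S[OF a]] invertible_commI[OF xC] by blast
  qed
qed

text \<open>Spectral permanence for positivity: the left side is tested in the ambient algebra, the
  right side only in \<open>C\<close>.\<close>

lemma cpositive_iff:
  assumes a: "a \<in> S"
  shows "cpositive sc st a \<longleftrightarrow> (\<forall>l\<in>\<Sigma>. 0 \<le> Re (l a))"
  using ch_cpositive[OF _ a] K_cpositive K_iff[OF a] by blast

text \<open>The constant is not optimal; it only serves to transfer convergence from the spectrum to $C$.\<close>

lemma norm_le_ch:
  assumes a: "a \<in> S" and e: "e > 0" and le: "\<And>l. l \<in> \<Sigma> \<Longrightarrow> \<bar>Re (l a)\<bar> \<le> e"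
  shows "norm a \<le> 6 * e"
proof -
  note aC = S_C[OF a]
  have "e *\<^sub>R 1 - a \<in> K" "e *\<^sub>R 1 + a \<in> K"
    using a le by (auto simp: K_iff S_diff S_add S_scaleR ch_diff ch_add ch_scaleR ch_1 C_scaleR aC abs_le_iff)
      (smt (verit) abs_le_iff le)+
  then obtain b c where b: "b \<in> K" "b * b = e *\<^sub>R 1 - a + e *\<^sub>R 1"
    and c: "c \<in> K" "c * c = e *\<^sub>R 1 + a + e *\<^sub>R 1"
    using K_sqrt e by metis
  \<comment> \<open>Adding the squares cancels \<open>a\<close>, so \<open>b * b\<close> has norm at
    most \<open>4 * e\<close>; together with the scalar \<open>2 * e\<close> this gives the factor
    6.\<close>
  have "b * b + c * c = (e + e + e + e) *\<^sub>R 1" unfolding b(2) c(2) scaleR_add_left by simp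
  then have "(norm b)\<^sup>2 \<le> e + e + e + e"
    using norm_sum_squares[OF K_S[OF b(1)] K_S[OF c(1)]] e by simp
  then have "norm (b * b) \<le> 4 * e" using norm_sa_square[OF S_st[OF K_S[OF b(1)]]] by simp
  moreover have "a = (e + e) *\<^sub>R 1 - b * b" unfolding b(2) scaleR_add_left by simp
  then have "norm a \<le> norm ((e + e) *\<^sub>R (1::'a)) + norm (b * b)" using norm_triangle_ineq4 by metis
  ultimately show ?thesis using e by simp
qed

lemma ch_separate:
  assumes a: "a \<in> S" and b: "b \<in> S" and eq: "\<And>l. l \<in> \<Sigma> \<Longrightarrow> Re (l a) = Re (l b)"
  shows "a = b"
proof -
  have "norm (a - b) \<le> 0 + e" if "e > 0" for e
    using norm_le_ch[of "a - b" "e/6"] a b eq that by (simp add: S_diff ch_diff S_C)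
  then have "norm (a - b) \<le> 0" by (rule field_le_epsilon)
  then show ?thesis by simp
qed

section \<open>Absolute values and positive parts\<close>

lemma sqrt_square_approx: "0 \<le> e \<Longrightarrow> \<bar>sqrt (x\<^sup>2 + e\<^sup>2) - \<bar>x\<bar>\<bar> \<le> e"
  using sqrt_add_le_add_sqrt[of "x\<^sup>2" "e\<^sup>2"] real_sqrt_le_mono[of "x\<^sup>2" "x\<^sup>2 + e\<^sup>2"]
  by (simp add: abs_le_iff)

lemma ch_tendsto:
  assumes l: "l \<in> \<Sigma>" and f: "\<And>n. f n \<in> C" "x \<in> C" "f \<longlonglongrightarrow> x"
  shows "(\<lambda>n. Re (l (f n))) \<longlonglongrightarrow> Re (l x)"
proof (rule tendsto_Re)
  have "(\<lambda>n. l (f n) - l x) \<longlonglongrightarrow> 0"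
  proof (rule Lim_null_comparison)
    show "\<forall>\<^sub>F n in sequentially. cmod (l (f n) - l x) \<le> norm (f n - x)"
      using ch_norm[OF l C_diff[OF f(1) f(2)]] by (simp add: ch_diff[OF l f(1) f(2)])
    show "(\<lambda>n. norm (f n - x)) \<longlonglongrightarrow> 0"
      using f(3) by (simp add: LIM_zero tendsto_norm_zero)
  qed
  then show "(\<lambda>n. l (f n)) \<longlonglongrightarrow> l x" by (simp add: LIM_zero_iff)
qed

text \<open>The roots of \<open>a * a + (e n)^2\<close> differ from the absolute value by at most
  \<open>e n\<close> at every character; \<open>norm_le_ch\<close> turns this uniform estimate into
  a Cauchy sequence in \<open>C\<close>.\<close>

lemma abs_exists:
  assumes a: "a \<in> S"
  shows "\<exists>s\<in>S. \<forall>l\<in>\<Sigma>. Re (l s) = \<bar>Re (l a)\<bar>"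
proof -
  define e where "e n = 1 / real (Suc n)" for n
  have e: "e n > 0" for n by (simp add: e_def)
  have e0: "e \<longlonglongrightarrow> 0" unfolding e_def by (rule LIMSEQ_Suc[OF lim_1_over_n])
  have "\<exists>s\<in>K. s * s = a * a + (e n)\<^sup>2 *\<^sub>R 1" for n
    using K_sqrt[OF K_square[OF a]] e[of n] by simp
  then obtain s where s: "s n \<in> K" "s n * s n = a * a + (e n)\<^sup>2 *\<^sub>R 1" for n by metis
  have sS: "s n \<in> S" for n using s by (intro K_S)
  have Re_mult: "Re (l (x * x)) = (Re (l x))\<^sup>2" if "l \<in> \<Sigma>" "x \<in> S" for l x
    using ch_mult[of l x x] ch_real[OF that] that S_C
    by (metis Re_complex_of_real of_real_mult power2_eq_square)
  have ls: "Re (l (s n)) = sqrt ((Re (l a))\<^sup>2 + (e n)\<^sup>2)" if l: "l \<in> \<Sigma>" for l n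
  proof -
    have "(Re (l (s n)))\<^sup>2 = Re (l (a * a + (e n)\<^sup>2 *\<^sub>R 1))" using Re_mult[OF l sS] s by metis
    also have "\<dots> = (Re (l a))\<^sup>2 + (e n)\<^sup>2"
      using Re_mult[OF l a] by (simp add: ch_add[OF l] ch_scaleR[OF l] ch_1[OF l] C_scaleR C_mult S_C[OF a])
    finally show ?thesis using ch_K[OF l s(1)] by (metis real_sqrt_unique)
  qed
  have near: "\<bar>Re (l (s n)) - \<bar>Re (l a)\<bar>\<bar> \<le> e n" if "l \<in> \<Sigma>" for l n
    using sqrt_square_approx[of "e n" "Re (l a)"] e[of n] ls[OF that] by simp
  have diff: "norm (s m - s n) \<le> 6 * (e m + e n)" for m n
  proof (rule norm_le_ch)
    show "s m - s n \<in> S" using sS by (rule S_diff[OF _ sS])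
    show "e m + e n > 0" using e[of m] e[of n] by simp
    fix l assume l: "l \<in> \<Sigma>"
    show "\<bar>Re (l (s m - s n))\<bar> \<le> e m + e n"
      using near[OF l, of m] near[OF l, of n] by (simp add: ch_diff[OF l S_C[OF sS] S_C[OF sS]])
  qed
  have "Cauchy s"
  proof (rule metric_CauchyI)
    fix d :: real assume d: "d > 0"
    obtain M where M: "\<And>n. n \<ge> M \<Longrightarrow> e n < d / 12"
      using order_tendstoD(2)[OF e0, of "d/12"] d by (auto simp: eventually_sequentially)
    have "dist (s m) (s n) < d" if "m \<ge> M" "n \<ge> M" for m n
      using diff[of m n] M[OF that(1)] M[OF that(2)] by (simp add: dist_norm)
    then show "\<exists>M. \<forall>m\<ge>M. \<forall>n\<ge>M. dist (s m) (s n) < d" by blast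
  qed
  then obtain t where t: "s \<longlonglongrightarrow> t" using Cauchy_convergent convergent_def by blast
  have tS: "t \<in> S" using S_closed sS t by (rule closed_sequentially)
  have "Re (l t) = \<bar>Re (l a)\<bar>" if l: "l \<in> \<Sigma>" for l
  proof (rule LIMSEQ_unique)
    show "(\<lambda>n. Re (l (s n))) \<longlonglongrightarrow> Re (l t)"
      by (rule ch_tendsto[OF l S_C[OF sS] S_C[OF tS] t])
    have "(\<lambda>n. Re (l (s n)) - \<bar>Re (l a)\<bar>) \<longlonglongrightarrow> 0"
      by (rule Lim_null_comparison[OF _ e0]) (simp add: near[OF l])
    then show "(\<lambda>n. Re (l (s n))) \<longlonglongrightarrow> \<bar>Re (l a)\<bar>" by (simp add: LIM_zero_iff)
  qed
  then show ?thesis using tS by blast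
qed

lemma pos_part_exists:
  assumes a: "a \<in> S"
  shows "\<exists>p\<in>S. \<exists>m\<in>S. cpositive sc st p \<and> cpositive sc st m \<and> p * m = 0 \<and> a = p - m"
proof -
  obtain s where s: "s \<in> S" "\<And>l. l \<in> \<Sigma> \<Longrightarrow> Re (l s) = \<bar>Re (l a)\<bar>" using abs_exists[OF a] by blast
  define p m where "p = (1/2) *\<^sub>R (s + a)" and "m = (1/2) *\<^sub>R (s - a)"
  have S: "p \<in> S" "m \<in> S" using s a by (auto simp: p_def m_def intro!: S_scaleR S_add S_diff)
  have lp: "Re (l p) = (\<bar>Re (l a)\<bar> + Re (l a)) / 2" "Re (l m) = (\<bar>Re (l a)\<bar> - Re (l a)) / 2"
    if l: "l \<in> \<Sigma>" for l
    using s(2)[OF l] S_C[OF a] S_C[OF s(1)]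
    by (simp_all add: p_def m_def ch_scaleR[OF l] ch_add[OF l] ch_diff[OF l] C_add C_diff)
  have "0 \<le> Re (l p)" "0 \<le> Re (l m)" if "l \<in> \<Sigma>" for l
    by (auto simp: lp[OF that] abs_if)
  then have "cpositive sc st p" "cpositive sc st m" using S by (auto simp: cpositive_iff)
  moreover have "p * m = 0"
  proof (rule ch_separate)
    show "p * m \<in> S" using S by (rule S_mult)
    fix l assume l: "l \<in> \<Sigma>"
    have "l (p * m) = of_real (Re (l p)) * of_real (Re (l m))"
      using ch_real[OF l S(1)] ch_real[OF l S(2)] ch_mult[OF l S_C[OF S(1)] S_C[OF S(2)]] by simp
    also have "\<dots> = 0" by (auto simp: lp[OF l])
    finally show "Re (l (p * m)) = Re (l 0)" by (simp add: ch_0[OF l])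
  qed simp
  moreover have "a = p - m" by (simp add: p_def m_def scaleR_add_right scaleR_diff_right flip: scaleR_add_left)
  ultimately show ?thesis using S by blast
qed

text \<open>Since \<open>p * m = 0\<close>, each character vanishes on \<open>p\<close> or on
  \<open>m\<close>.\<close>

lemma ch_pos_part:
  assumes "p \<in> S" "m \<in> S" "cpositive sc st p" "cpositive sc st m" "p * m = 0" and l: "l \<in> \<Sigma>"
  shows "Re (l p) = max (Re (l (p - m))) 0"
proof -
  have "l p * l m = 0" using assms ch_mult[of l p m] by (simp add: S_C ch_0)
  moreover have "0 \<le> Re (l p)" "0 \<le> Re (l m)" using assms cpositive_iff by blast+
  ultimately show ?thesis using assms by (auto simp: ch_diff S_C)
qed

end

context cstar
begin

section \<open>Bicommutants and uniqueness of the positive part\<close>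

definition commutant :: "'a set \<Rightarrow> 'a set" where
  "commutant T = {x. \<forall>y\<in>T. x * y = y * x}"

lemma commutant_antimono: "T \<subseteq> T' \<Longrightarrow> commutant T' \<subseteq> commutant T"
  by (auto simp: commutant_def)

lemma subset_bicommutant: "T \<subseteq> commutant (commutant T)"
  by (auto simp: commutant_def)

lemma commutant_st:
  assumes "\<And>x. x \<in> T \<Longrightarrow> st x \<in> T" "x \<in> commutant T"
  shows "st x \<in> commutant T"
proof -
  have "st x * y = y * st x" if "y \<in> T" for y
  proof -
    have "x * st y = st y * x" using assms that by (auto simp: commutant_def)
    then have "st (x * st y) = st (st y * x)" by simp
    then show ?thesis by (simp add: st_mult st_st)
  qed
  then show ?thesis by (simp add: commutant_def)
qed

lemma closed_commutant: "closed (commutant T)"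
proof -
  have "closed {x. x * y = y * x}" for y :: 'a
    by (intro closed_Collect_eq continuous_intros)
  then have "closed (\<Inter>y\<in>T. {x. x * y = y * x})" by blast
  moreover have "commutant T = (\<Inter>y\<in>T. {x. x * y = y * x})" by (auto simp: commutant_def)
  ultimately show ?thesis by simp
qed

text \<open>Commuting generators lie in their own commutant, so the bicommutant is contained in the
  commutant, all of whose elements it commutes with.\<close>

lemma bicommutant_CA:
  assumes sa: "\<And>x. x \<in> T \<Longrightarrow> st x = x" and comm: "\<And>x y. x \<in> T \<Longrightarrow> y \<in> T \<Longrightarrow> x * y = y * x"
  shows "commutant (commutant T) \<in> CA sc st"
proof -
  let ?B = "commutant (commutant T)"
  have "T \<subseteq> commutant T" using comm by (auto simp: commutant_def)
  then have "?B \<subseteq> commutant T" by (rule commutant_antimono)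
  then have "x * y = y * x" if "x \<in> ?B" "y \<in> ?B" for x y
    using that unfolding commutant_def[of "commutant T"] by blast
  moreover have "x + y \<in> ?B" "x * y \<in> ?B" if "x \<in> ?B" "y \<in> ?B" for x y
  proof -
    show "x + y \<in> ?B" using that by (auto simp: commutant_def algebra_simps)
    have "x * y * z = z * (x * y)" if "z \<in> commutant T" for z
      using \<open>x \<in> ?B\<close> \<open>y \<in> ?B\<close> that by (metis (mono_tags, lifting) commutant_def mem_Collect_eq mult.assoc)
    then show "x * y \<in> ?B" unfolding commutant_def[of "commutant T"] by blast
  qed
  moreover have "sc z x \<in> ?B" if "x \<in> ?B" for z x
    using that by (auto simp: commutant_def sc_mult_left sc_mult_right)
  moreover have "st x \<in> ?B" if "x \<in> ?B" for x
    by (rule commutant_st[OF commutant_st that]) (auto simp: sa)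
  moreover have "1 \<in> ?B" by (simp add: commutant_def)
  ultimately show ?thesis using closed_commutant by (auto simp: CA_def comm_subalg_def)
qed

lemma csubI: "C \<in> CA sc st \<Longrightarrow> csub sc st C"
  by unfold_locales

text \<open>An arbitrary decomposition need not lie in the given subalgebra, but $\{p, m\}''$ is a commutative
subalgebra that contains it together with the decomposition found in $\{p - m\}''$.\<close>

lemma pos_part_eq:
  assumes pm: "cpositive sc st p" "cpositive sc st m" "p * m = 0"
  shows "pos_part sc st (p - m) = p"
proof -
  define a where "a = p - m"
  define A where "A = commutant (commutant {a})"
  have sa: "st p = p" "st m = m" if "cpositive sc st p" "cpositive sc st m" for p m
    using that by (auto simp: cpositive_def)
  have "st a = a" using sa[OF pm(1,2)] by (simp add: a_def st_diff)
  then have A: "A \<in> CA sc st" unfolding A_def by (intro bicommutant_CA) auto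
  interpret A: csub sc st A by (rule csubI[OF A])
  have "a \<in> A" using subset_bicommutant[of "{a}"] by (simp add: A_def)
  then have "a \<in> A.S" using \<open>st a = a\<close> by (rule A.S_I)
  then obtain p0 m0 where p0: "p0 \<in> A.S" "m0 \<in> A.S" "cpositive sc st p0" "cpositive sc st m0"
    "p0 * m0 = 0" "a = p0 - m0"
    using A.pos_part_exists by blast
  have unique: "p = p0" if p: "cpositive sc st p" "cpositive sc st m" "p * m = 0" "a = p - m" for p m
  proof -
    define B where "B = commutant (commutant {p, m})"
    have "st (p * m) = m * p" using sa[OF p(1,2)] by (simp add: st_mult)
    then have mp: "m * p = 0" using p by simp
    have B: "B \<in> CA sc st"
      unfolding B_def using sa[OF p(1,2)] p(3) mp by (intro bicommutant_CA) auto
    interpret B: csub sc st B by (rule csubI[OF B])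
    have "commutant {p, m} \<subseteq> commutant {a}" by (auto simp: commutant_def p(4) algebra_simps)
    then have "A \<subseteq> B" unfolding A_def B_def by (rule commutant_antimono)
    then have 0: "p0 \<in> B.S" "m0 \<in> B.S" using p0 by (auto simp: Csa_def)
    have "{p, m} \<subseteq> B" unfolding B_def by (rule subset_bicommutant)
    then have 1: "p \<in> B.S" "m \<in> B.S" using sa[OF p(1,2)] by (auto intro: B.S_I)
    show "p = p0"
      by (rule B.ch_separate[OF 1(1) 0(1)])
        (use B.ch_pos_part[OF 0 p0(3-5)] B.ch_pos_part[OF 1 p(1-3)] p(4) p0(6) in auto)
  qed
  have "p = p0" by (rule unique[OF pm a_def])
  then have "pos_part sc st a = p"
    unfolding pos_part_def using pm a_def unique by (intro the_equality) blast+
  then show ?thesis by (simp add: a_def)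
qed

text \<open>The set \<open>Xa\<close> read off a class instead of a representative, so that unions
  over subsets of \<open>LC\<close> make sense.\<close>

definition supp :: "'a set \<Rightarrow> 'a set \<Rightarrow> ('a \<Rightarrow> complex) set" where
  "supp C D = {l \<in> characters sc C. \<exists>b\<in>D. 0 < Re (l b)}"

end

context csub
begin

lemma pos_part_S:
  assumes a: "a \<in> S"
  shows "pos_part sc st a \<in> S" "l \<in> \<Sigma> \<Longrightarrow> Re (l (pos_part sc st a)) = max (Re (l a)) 0"
proof -
  obtain p m where "p \<in> S" "m \<in> S" "cpositive sc st p" "cpositive sc st m" "p * m = 0" "a = p - m"
    using pos_part_exists[OF a] by blast
  then show "pos_part sc st a \<in> S" "l \<in> \<Sigma> \<Longrightarrow> Re (l (pos_part sc st a)) = max (Re (l a)) 0"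
    using pos_part_eq ch_pos_part by auto
qed

section \<open>The lattice $L_C$\<close>

abbreviation P :: "'a set" where "P \<equiv> Cplus sc st C"

lemma P_iff: "a \<in> P \<longleftrightarrow> a \<in> S \<and> (\<forall>l\<in>\<Sigma>. 0 \<le> Re (l a))"
  using cpositive_iff by (auto simp: Cplus_def)

lemma P_S: "a \<in> P \<Longrightarrow> a \<in> S"
  by (simp add: Cplus_def)

lemma pos_part_P: "a \<in> S \<Longrightarrow> pos_part sc st a \<in> P"
  by (auto simp: P_iff pos_part_S)

lemma pos_part_id:
  assumes "a \<in> P"
  shows "pos_part sc st a = a"
  using assms pos_part_S[of a] by (intro ch_separate) (auto simp: P_iff)

lemma precsim_iff:
  assumes "a \<in> S" "b \<in> S"
  shows "precsim sc st a b \<longleftrightarrow> (\<exists>n::nat. \<forall>l\<in>\<Sigma>. Re (l a) \<le> real n * Re (l b))"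
proof -
  have "cle sc st a (of_nat n * b) \<longleftrightarrow> (\<forall>l\<in>\<Sigma>. Re (l a) \<le> real n * Re (l b))" for n
  proof -
    have eq: "of_nat n * b = real n *\<^sub>R b" by (simp add: scaleR_conv_of_real)
    show ?thesis
      unfolding cle_def eq using assms
      by (subst cpositive_iff) (auto simp: S_diff S_scaleR ch_diff ch_scaleR C_scaleR S_C)
  qed
  then show ?thesis by (simp add: precsim_def)
qed

lemma precsim_refl: "a \<in> S \<Longrightarrow> precsim sc st a a"
  by (auto simp: precsim_iff intro!: exI[of _ "1::nat"])

lemma precsim_trans:
  assumes "a \<in> S" "b \<in> S" "c \<in> S" "precsim sc st a b" "precsim sc st b c"
  shows "precsim sc st a c"
proof -
  obtain n m :: nat where n: "\<And>l. l \<in> \<Sigma> \<Longrightarrow> Re (l a) \<le> real n * Re (l b)"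
    and m: "\<And>l. l \<in> \<Sigma> \<Longrightarrow> Re (l b) \<le> real m * Re (l c)"
    using assms by (auto simp: precsim_iff)
  have "Re (l a) \<le> real (n * m) * Re (l c)" if "l \<in> \<Sigma>" for l
    using n[OF that] mult_left_mono[OF m[OF that], of "real n"] by simp
  then show ?thesis unfolding precsim_iff[OF assms(1,3)] by blast
qed

lemma Lcls_self: "a \<in> P \<Longrightarrow> a \<in> Lcls sc st C a"
  by (simp add: Lcls_def precsim_refl P_S)

lemma Lcls_eq: "a \<in> P \<Longrightarrow> b \<in> P \<Longrightarrow> precsim sc st a b \<Longrightarrow> precsim sc st b a \<Longrightarrow> Lcls sc st C a = Lcls sc st C b"
  unfolding Lcls_def by (blast intro: precsim_trans P_S)

lemma Lle_Lcls:
  assumes "a \<in> P" "b \<in> P"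
  shows "Lle sc st (Lcls sc st C a) (Lcls sc st C b) \<longleftrightarrow> precsim sc st a b"
proof
  assume "Lle sc st (Lcls sc st C a) (Lcls sc st C b)"
  then obtain a' b' where "a' \<in> P" "b' \<in> P" "precsim sc st a a'" "precsim sc st a' b'" "precsim sc st b' b"
    by (auto simp: Lle_def Lcls_def)
  then show "precsim sc st a b" using assms by (meson P_S precsim_trans)
next
  assume "precsim sc st a b"
  then show "Lle sc st (Lcls sc st C a) (Lcls sc st C b)" using assms Lcls_self by (auto simp: Lle_def)
qed

text \<open>A positive element is its own positive part, so conditions stated for the classes
  \<open>DD\<close> reach all of \<open>LC\<close>.\<close>

lemma LC_E:
  assumes "D \<in> LC sc st C"
  obtains b where "b \<in> P" "D = DD sc st C b"
  using assms pos_part_id by (auto simp: LC_def DD_def)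

lemma DD_LC: "a \<in> S \<Longrightarrow> DD sc st C a \<in> LC sc st C"
  by (simp add: DD_def LC_def pos_part_P)

text \<open>If \<open>c\<close> is below a multiple of \<open>b\<close>, then \<open>b\<close> is
  positive wherever \<open>c\<close> is, so the other representatives add no points.\<close>

lemma supp_Lcls:
  assumes b: "b \<in> P"
  shows "supp C (Lcls sc st C b) = Xa sc C b"
proof -
  have "0 < Re (l b)" if c: "c \<in> P" "precsim sc st c b" and l: "l \<in> \<Sigma>" "0 < Re (l c)" for c l
  proof -
    obtain n :: nat where "Re (l c) \<le> real n * Re (l b)"
      using c b l by (auto simp: precsim_iff P_S)
    then have "0 < real n * Re (l b)" using l by linarith
    then show ?thesis by (simp add: zero_less_mult_iff)
  qed
  then show ?thesis using Lcls_self[OF b] by (auto simp: supp_def Xa_def Lcls_def)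
qed

lemma supp_DD: "a \<in> S \<Longrightarrow> supp C (DD sc st C a) = Xa sc C a"
  unfolding DD_def supp_Lcls[OF pos_part_P] by (auto simp: Xa_def pos_part_S)

lemma P_sum: "(\<And>i. i \<in> I \<Longrightarrow> f i \<in> P) \<Longrightarrow> (\<Sum>i\<in>I. f i) \<in> P"
  by (auto simp: P_iff ch_sum S_C intro!: S_sum sum_nonneg)

text \<open>For finitely many nonnegative functions the sum lies between the maximum and a multiple
  of it, so it represents the join. The empty family correctly yields the class of 0.\<close>

lemma Ljoin_eq:
  assumes fin: "finite U0" and r: "\<And>D. D \<in> U0 \<Longrightarrow> r D \<in> P \<and> Lcls sc st C (r D) = D"
  shows "Ljoin sc st C U0 = Lcls sc st C (\<Sum>D\<in>U0. r D)"
proof -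
  define B where "B = (\<Sum>D\<in>U0. r D)"
  have B: "B \<in> P" using r by (simp add: B_def P_sum)
  have lB: "Re (l B) = (\<Sum>D\<in>U0. Re (l (r D)))" if "l \<in> \<Sigma>" for l
    using that r by (simp add: B_def ch_sum S_C P_S)
  have upper: "Lle sc st D (Lcls sc st C B)" if D: "D \<in> U0" for D
  proof -
    have "Re (l (r D)) \<le> Re (l B)" if l: "l \<in> \<Sigma>" for l
      unfolding lB[OF l] by (rule member_le_sum[OF D]) (use r l fin in \<open>auto simp: P_iff\<close>)
    then have "precsim sc st (r D) B" using r[OF D] B
      by (auto simp: precsim_iff P_S intro!: exI[of _ "1::nat"])
    then show ?thesis using Lle_Lcls[of "r D" B] r[OF D] B by simp
  qed
  have least: "precsim sc st B v" if v: "v \<in> P" "\<And>D. D \<in> U0 \<Longrightarrow> Lle sc st D (Lcls sc st C v)" for v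
  proof -
    have "\<exists>n::nat. \<forall>l\<in>\<Sigma>. Re (l (r D)) \<le> real n * Re (l v)" if D: "D \<in> U0" for D
      using v(2)[OF D] Lle_Lcls[of "r D" v] r[OF D] v(1) by (simp add: precsim_iff P_S)
    then obtain n :: "'a set \<Rightarrow> nat"
      where n: "\<And>D l. D \<in> U0 \<Longrightarrow> l \<in> \<Sigma> \<Longrightarrow> Re (l (r D)) \<le> real (n D) * Re (l v)" by metis
    have "Re (l B) \<le> real (\<Sum>D\<in>U0. n D) * Re (l v)" if l: "l \<in> \<Sigma>" for l
      unfolding lB[OF l] using sum_mono[of U0 "\<lambda>D. Re (l (r D))" "\<lambda>D. real (n D) * Re (l v)"] n l
      by (simp add: sum_distrib_right)
    then show ?thesis unfolding precsim_iff[OF P_S[OF B] P_S[OF v(1)]] by blast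
  qed
  show ?thesis
    unfolding Ljoin_def B_def[symmetric]
  proof (rule the_equality)
    show "Lcls sc st C B \<in> LC sc st C \<and> (\<forall>x\<in>U0. Lle sc st x (Lcls sc st C B)) \<and>
      (\<forall>v\<in>LC sc st C. (\<forall>x\<in>U0. Lle sc st x v) \<longrightarrow> Lle sc st (Lcls sc st C B) v)"
      using B upper least by (auto simp: LC_def Lle_Lcls)
    fix u assume u: "u \<in> LC sc st C \<and> (\<forall>x\<in>U0. Lle sc st x u) \<and>
      (\<forall>v\<in>LC sc st C. (\<forall>x\<in>U0. Lle sc st x v) \<longrightarrow> Lle sc st u v)"
    then obtain b where b: "b \<in> P" "u = Lcls sc st C b" by (auto simp: LC_def)
    have "Lle sc st u (Lcls sc st C B)" using u upper B by (auto simp: LC_def)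
    then have "precsim sc st b B" using b B Lle_Lcls by simp
    moreover have "precsim sc st B b" using least b u by blast
    ultimately have "Lcls sc st C b = Lcls sc st C B" by (rule Lcls_eq[OF b(1) B])
    then show "u = Lcls sc st C B" using b(2) by (rule trans[rotated])
  qed
qed

section \<open>The spectrum and the covering relation\<close>

abbreviation PT :: "('a \<Rightarrow> complex) topology" where
  "PT \<equiv> product_topology (\<lambda>_. euclidean) C"

lemma topspace_PT: "topspace PT = extensional C"
  by (simp add: PiE_UNIV_domain PiE_def)

lemma topspace_gelfand_top: "topspace (gelfand_top sc C) = \<Sigma>"
  unfolding gelfand_top_def topspace_subtopology topspace_PT by (auto simp: characters_def)

lemma continuous_map_eval: "x \<in> C \<Longrightarrow> continuous_map PT euclidean (\<lambda>l. l x)"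
  by (rule continuous_map_product_projection)

lemma closedin_characters: "closedin PT \<Sigma>"
proof -
  define E where "E = (\<lambda>(x, y, z). {l \<in> topspace PT. l (x + y) = l x + l y} \<inter>
    {l \<in> topspace PT. l (x * y) = l x * l y} \<inter> {l \<in> topspace PT. l (sc z x) = z * l x} \<inter>
    {l \<in> topspace PT. l 1 = 1})"
  have mult: "continuous_map PT euclidean (\<lambda>l. f l * g l)"
    if "continuous_map PT euclidean f" "continuous_map PT euclidean g"
    for f g :: "('a \<Rightarrow> complex) \<Rightarrow> complex"
    using that by (simp add: continuous_map_atin tendsto_mult)
  have "closedin PT (E (x, y, z))" if "x \<in> C" "y \<in> C" for x y z
    unfolding E_def prod.case using that
    by (intro closedin_Int closedin_continuous_maps_eq[OF Hausdorff_space_euclidean]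
        continuous_map_eval continuous_map_add mult C_add C_mult C_sc C_1) auto
  \<comment> \<open>An empty intersection would not be confined to the topspace.\<close>
  moreover have "C \<times> C \<times> (UNIV :: complex set) \<noteq> {}" using C_1 by blast
  ultimately have "closedin PT (\<Inter>p\<in>C \<times> C \<times> UNIV. E p)" by (intro closedin_INT) auto
  moreover have "\<Sigma> = (\<Inter>p\<in>C \<times> C \<times> UNIV. E p)"
  proof -
    have E_iff: "l \<in> E (x, y, z) \<longleftrightarrow> l \<in> extensional C \<and> l (x + y) = l x + l y \<and>
        l (x * y) = l x * l y \<and> l (sc z x) = z * l x \<and> l 1 = 1" for l x y z
      unfolding E_def topspace_PT by auto
    have "l \<in> \<Sigma> \<longleftrightarrow> (\<forall>x\<in>C. \<forall>y\<in>C. \<forall>z. l \<in> E (x, y, z))" for l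
      unfolding E_iff characters_def using C_1 by blast
    then show ?thesis by auto
  qed
  ultimately show ?thesis by simp
qed

text \<open>Tychonoff: by \<open>ch_norm\<close> the spectrum is a closed part of a product of discs
  of radius \<open>norm x\<close>.\<close>

lemma compact_space_gelfand_top: "compact_space (gelfand_top sc C)"
proof -
  have "compactin PT (\<Pi>\<^sub>E x\<in>C. cball 0 (norm x))" by (simp add: compactin_PiE)
  moreover have "\<Sigma> \<subseteq> (\<Pi>\<^sub>E x\<in>C. cball 0 (norm x))"
  proof
    fix l assume "l \<in> \<Sigma>"
    then show "l \<in> (\<Pi>\<^sub>E x\<in>C. cball 0 (norm x))"
      using ch_norm[of l] unfolding PiE_iff by (simp add: characters_def)
  qed
  ultimately have "compactin PT \<Sigma>" using closedin_characters by (rule closed_compactin)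
  then show ?thesis unfolding gelfand_top_def by (rule compact_space_subtopology)
qed

lemma openin_gt:
  assumes "x \<in> C"
  shows "openin (gelfand_top sc C) {l \<in> \<Sigma>. c < Re (l x)}"
proof -
  have "continuous_map (gelfand_top sc C) euclidean (\<lambda>l. l x)"
    unfolding gelfand_top_def by (intro continuous_map_from_subtopology continuous_map_eval assms)
  moreover have "open {z. c < Re z}" by (rule open_halfspace_Re_gt)
  ultimately have "openin (gelfand_top sc C) {l \<in> topspace (gelfand_top sc C). l x \<in> {z. c < Re z}}"
    by (intro openin_continuous_map_preimage[where Y = euclidean]) auto
  then show ?thesis by (simp add: topspace_gelfand_top)
qed

lemma openin_Xa: "a \<in> S \<Longrightarrow> openin (gelfand_top sc C) (Xa sc C a)"
  unfolding Xa_def by (rule openin_gt) (rule S_C)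

text \<open>If $W$ contains the points $k$ with $|k(x) - l(x)| < e$ for $x$ in the finite set $F$, take
$a = e^2 - \sum_{x\in F} (x - l(x))^*(x - l(x))$.\<close>

lemma Xa_base:
  assumes W: "openin (gelfand_top sc C) W" and l: "l \<in> W"
  shows "\<exists>a\<in>S. l \<in> Xa sc C a \<and> Xa sc C a \<subseteq> W"
proof -
  obtain T where T: "openin PT T" "W = T \<inter> \<Sigma>"
    using W by (auto simp: gelfand_top_def openin_subtopology)
  have lS: "l \<in> \<Sigma>" using l T by simp
  obtain U where U: "finite {x\<in>C. U x \<noteq> UNIV}" "\<forall>x\<in>C. open (U x)" "l \<in> Pi\<^sub>E C U" "Pi\<^sub>E C U \<subseteq> T"
  proof -
    have "l \<in> T" using l T by simp
    then show ?thesis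
      using that T(1)
      unfolding openin_product_topology_alt open_openin[symmetric] topspace_euclidean by blast
  qed
  define F where "F = {x\<in>C. U x \<noteq> UNIV}"
  have FC: "\<And>x. x \<in> F \<Longrightarrow> x \<in> C" and finF: "finite F" using U by (auto simp: F_def)
  have "\<exists>e>0. ball (l x) e \<subseteq> U x" if "x \<in> F" for x
  proof -
    have "open (U x)" "l x \<in> U x" using U FC[OF that] by auto
    then show ?thesis by (rule openE) blast
  qed
  then obtain d where d: "\<And>x. x \<in> F \<Longrightarrow> d x > 0 \<and> ball (l x) (d x) \<subseteq> U x" by metis
  \<comment> \<open>Inserting 1 provides a minimum even if no coordinate is constrained.\<close>
  define e where "e = Min (insert 1 (d ` F))"
  have e: "e > 0" "\<And>x. x \<in> F \<Longrightarrow> e \<le> d x" using finF d by (auto simp: e_def)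
  define y where "y x = x - sc (l x) 1" for x
  have yC: "y x \<in> C" if "x \<in> F" for x using FC[OF that] by (auto simp: y_def intro!: C_diff C_sc)
  define a where "a = e\<^sup>2 *\<^sub>R 1 - (\<Sum>x\<in>F. st (y x) * y x)"
  have aS: "a \<in> S" unfolding a_def by (intro S_diff S_scaleR S_1 S_sum st_mult_S yC)
  have ka: "Re (k a) = e\<^sup>2 - (\<Sum>x\<in>F. (cmod (k x - l x))\<^sup>2)" if k: "k \<in> \<Sigma>" for k
  proof -
    have "k (y x) = k x - l x" if "x \<in> F" for x
      using FC[OF that] by (simp add: y_def ch_diff[OF k] ch_sc[OF k] ch_1[OF k] C_sc)
    then have "k (st (y x) * y x) = of_real ((cmod (k x - l x))\<^sup>2)" if "x \<in> F" for x
      using ch_st_mult[OF k yC[OF that]] that by simp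
    moreover have "st (y x) * y x \<in> C" if "x \<in> F" for x by (intro S_C st_mult_S yC that)
    ultimately have "k (\<Sum>x\<in>F. st (y x) * y x) = (\<Sum>x\<in>F. of_real ((cmod (k x - l x))\<^sup>2))"
      "(\<Sum>x\<in>F. st (y x) * y x) \<in> C"
      by (auto simp: ch_sum[OF k] C_sum simp del: of_real_power)
    then show ?thesis
      by (simp add: a_def ch_diff[OF k] ch_scaleR[OF k] ch_1[OF k] C_scaleR del: of_real_power)
  qed
  have "k \<in> W" if k: "k \<in> \<Sigma>" "0 < Re (k a)" for k
  proof -
    have "k x \<in> U x" if x: "x \<in> C" for x
    proof (cases "x \<in> F")
      case True
      have "(cmod (k x - l x))\<^sup>2 \<le> (\<Sum>x\<in>F. (cmod (k x - l x))\<^sup>2)"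
        by (rule member_le_sum[OF True]) (use finF in auto)
      also have "\<dots> < e\<^sup>2" using k ka by simp
      finally have "cmod (k x - l x) < e" by (rule power2_less_imp_less[OF _ less_imp_le[OF e(1)]])
      then have "k x \<in> ball (l x) (d x)"
        using e(2)[OF True] by (simp add: dist_norm norm_minus_commute)
      then show ?thesis using d[OF True] by blast
    qed (use x in \<open>simp add: F_def\<close>)
    moreover have "k \<in> extensional C" using k by (simp add: characters_def)
    ultimately have "k \<in> Pi\<^sub>E C U" by (auto simp: PiE_def)
    then show "k \<in> W" using U T k by blast
  qed
  moreover have "0 < Re (l a)" using ka[OF lS] e by simp
  ultimately show ?thesis using aS lS by (auto simp: Xa_def)
qed

section \<open>The covering relation as inclusion of open sets\<close>

lemma covers_imp_subset:
  assumes a: "a \<in> S" and U: "U \<subseteq> LC sc st C" and cov: "covers sc st C a U"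
  shows "Xa sc C a \<subseteq> (\<Union>D\<in>U. supp C D)"
proof
  fix l assume "l \<in> Xa sc C a"
  then have l: "l \<in> \<Sigma>" "0 < Re (l a)" by (auto simp: Xa_def)
  \<comment> \<open>A cut strictly below \<open>l a\<close> leaves the positive part of
    \<open>a - q\<close> positive at \<open>l\<close>.\<close>
  then obtain q where q: "q \<in> \<rat>" "0 < q" "q < Re (l a)" using Rats_dense_in_real by blast
  define p where "p = pos_part sc st (a - of_real q)"
  have aq: "a - of_real q \<in> S" using a by (auto simp: of_real_def intro!: S_diff S_scaleR)
  obtain U0 where U0: "finite U0" "U0 \<subseteq> U" "Lle sc st (Lcls sc st C p) (Ljoin sc st C U0)"
    using cov q unfolding covers_def DD_def p_def by blast
  have "\<forall>D\<in>U0. \<exists>b. b \<in> P \<and> Lcls sc st C b = D" using U0 U by (auto simp: LC_def)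
  then obtain r where r: "\<And>D. D \<in> U0 \<Longrightarrow> r D \<in> P \<and> Lcls sc st C (r D) = D" by metis
  define B where "B = (\<Sum>D\<in>U0. r D)"
  have B: "B \<in> P" using r by (simp add: B_def P_sum)
  have p: "p \<in> P" unfolding p_def by (rule pos_part_P[OF aq])
  have "precsim sc st p B"
    using U0(3) Ljoin_eq[OF U0(1) r] Lle_Lcls[OF p B] by (simp add: B_def)
  then obtain n :: nat where n: "Re (l p) \<le> real n * Re (l B)"
    using l p B by (auto simp: precsim_iff P_S)
  have "Re (l (a - of_real q)) = Re (l a) - q"
    using l S_C[OF a] by (simp add: of_real_def ch_diff ch_scaleR ch_1 C_scaleR)
  then have "0 < Re (l p)" using pos_part_S(2)[OF aq l(1)] q by (simp add: p_def)
  then have "0 < real n * Re (l B)" using n by linarith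
  then have "0 < Re (l B)" by (simp add: zero_less_mult_iff)
  moreover have "Re (l B) = (\<Sum>D\<in>U0. Re (l (r D)))"
    using l r by (simp add: B_def ch_sum S_C P_S)
  ultimately have "\<not> (\<forall>D\<in>U0. Re (l (r D)) \<le> 0)" by (metis linorder_not_le sum_nonpos)
  then obtain D where D: "D \<in> U0" "0 < Re (l (r D))" by force
  then have "l \<in> supp C D" using supp_Lcls[of "r D"] r[OF D(1)] l by (auto simp: Xa_def)
  then show "l \<in> (\<Union>D\<in>U. supp C D)" using D U0 by blast
qed

text \<open>Where $a \ge q$, compactness yields finitely many $D$ and an $N$ with $N \cdot \sum_D r_D \ge 1$;
elsewhere $(a - q)^+$ vanishes.\<close>

lemma subset_imp_covers:
  assumes a: "a \<in> S" and U: "U \<subseteq> LC sc st C" and sub: "Xa sc C a \<subseteq> (\<Union>D\<in>U. supp C D)"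
  shows "covers sc st C a U"
  unfolding covers_def
proof (intro ballI impI)
  fix q :: real assume q: "q > 0"
  have "\<forall>D\<in>U. \<exists>b. b \<in> P \<and> Lcls sc st C b = D" using U by (auto simp: LC_def)
  then obtain r where r: "\<And>D. D \<in> U \<Longrightarrow> r D \<in> P \<and> Lcls sc st C (r D) = D" by metis
  \<comment> \<open>As \<open>n\<close> grows these sets exhaust the support of \<open>D\<close>, by
    the Archimedean property.\<close>
  define V where "V = (\<lambda>(D, n). {l\<in>\<Sigma>. 1 < Re (l (real n *\<^sub>R r D))})"
  \<comment> \<open>The region \<open>a < q\<close>, expressed through \<open>- a\<close> to fit
    \<open>openin_gt\<close>.\<close>
  define V0 where "V0 = {l\<in>\<Sigma>. - q < Re (l (- 1 *\<^sub>R a))}"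
  have "\<exists>\<F>. finite \<F> \<and> \<F> \<subseteq> insert V0 (V ` (U \<times> UNIV)) \<and> \<Sigma> \<subseteq> \<Union>\<F>"
  proof -
    have "openin (gelfand_top sc C) X" if X: "X \<in> insert V0 (V ` (U \<times> UNIV))" for X
    proof (cases "X = V0")
      case True
      then show ?thesis unfolding V0_def by (simp only:) (intro openin_gt C_scaleR S_C a)
    next
      case False
      then obtain D n where "D \<in> U" "X = V (D, n)" using X by auto
      moreover from this have "r D \<in> C" using r by (intro S_C P_S) blast
      ultimately show ?thesis unfolding V_def by (auto intro!: openin_gt C_scaleR)
    qed
    moreover have "l \<in> \<Union>(insert V0 (V ` (U \<times> UNIV)))" if l: "l \<in> \<Sigma>" for l
    proof (cases "Re (l a) < q")
      case True
      then have "l \<in> V0" using l S_C[OF a] ch_scaleR[OF l, of a "- 1"] by (simp add: V0_def)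
      then show ?thesis by blast
    next
      case False
      then have "l \<in> Xa sc C a" using l q by (simp add: Xa_def)
      then obtain D where D: "D \<in> U" "l \<in> supp C D" using sub by blast
      then have pos: "0 < Re (l (r D))" using supp_Lcls[of "r D"] r[OF D(1)] by (auto simp: Xa_def)
      then obtain n :: nat where "1 < real n * Re (l (r D))" using reals_Archimedean3 by blast
      then have "l \<in> V (D, n)"
        using l r[OF D(1)] by (simp add: V_def ch_scaleR S_C P_S)
      then show ?thesis using D(1) by (intro UnionI[of "V (D, n)"]) simp_all
    qed
    then have "\<Sigma> \<subseteq> \<Union>(insert V0 (V ` (U \<times> UNIV)))" by (rule subsetI)
    ultimately show ?thesis
      using compact_space_gelfand_top unfolding compact_space_alt topspace_gelfand_top by meson
  qed
  then obtain \<F> where F: "finite \<F>" "\<F> \<subseteq> insert V0 (V ` (U \<times> UNIV))" "\<Sigma> \<subseteq> \<Union>\<F>" by blast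
  \<comment> \<open>\<open>V0\<close> carries no index; the remaining members can be pulled back to
    finitely many pairs.\<close>
  have "finite (\<F> - {V0})" "\<F> - {V0} \<subseteq> V ` (U \<times> UNIV)" using F by auto
  from finite_subset_image[OF this]
  obtain T where T: "T \<subseteq> U \<times> UNIV" "finite T" "\<F> - {V0} = V ` T" by blast
  define U0 where "U0 = fst ` T"
  have U0: "finite U0" "U0 \<subseteq> U" using T by (auto simp: U0_def)
  \<comment> \<open>An upper bound for all multipliers in \<open>T\<close>; a sum covers empty
    \<open>T\<close> as well.\<close>
  define N where "N = (\<Sum>t\<in>T. snd t)"
  define B where "B = (\<Sum>D\<in>U0. r D)"
  have rU0: "r D \<in> P \<and> Lcls sc st C (r D) = D" if "D \<in> U0" for D using r U0 that by blast
  have B: "B \<in> P" using rU0 by (simp add: B_def P_sum)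
  have lB: "Re (l B) = (\<Sum>D\<in>U0. Re (l (r D)))" if "l \<in> \<Sigma>" for l
    using that rU0 by (simp add: B_def ch_sum S_C P_S)
  have NB: "1 \<le> real N * Re (l B)" if l: "l \<in> \<Sigma>" and ge: "q \<le> Re (l a)" for l
  proof -
    have "l \<notin> V0" using ge l S_C[OF a] ch_scaleR[OF l, of a "- 1"] by (simp add: V0_def)
    then have "l \<in> \<Union>(V ` T)" using F(3) l T(3) by blast
    then obtain D n where Dn: "(D, n) \<in> T" "l \<in> V (D, n)" by auto
    have D: "D \<in> U0" using Dn by (force simp: U0_def)
    have 1: "1 < real n * Re (l (r D))"
      using Dn rU0[OF D] l by (simp add: V_def ch_scaleR S_C P_S)
    have "n \<le> N" unfolding N_def using member_le_sum[OF Dn(1), of snd] T(2) by simp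
    moreover have "Re (l (r D)) \<le> Re (l B)"
      unfolding lB[OF l] by (rule member_le_sum[OF D]) (use rU0 l U0 in \<open>auto simp: P_iff\<close>)
    moreover have "0 \<le> Re (l (r D))" using rU0[OF D] l by (simp add: P_iff)
    ultimately have "real n * Re (l (r D)) \<le> real N * Re (l B)" by (intro mult_mono) auto
    then show ?thesis using 1 by linarith
  qed
  have aq: "a - of_real q \<in> S" using a by (auto simp: of_real_def intro!: S_diff S_scaleR)
  define p where "p = pos_part sc st (a - of_real q)"
  have p: "p \<in> P" unfolding p_def by (rule pos_part_P[OF aq])
  \<comment> \<open>Scales \<open>1 \<le> N * l B\<close> up to the height of the positive part of
    \<open>a - q\<close>, which is at most \<open>norm a\<close>.\<close>
  obtain M :: nat where M: "norm a \<le> real M" using real_arch_simple by blast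
  have "Re (l p) \<le> real (M * N) * Re (l B)" if l: "l \<in> \<Sigma>" for l
  proof -
    have lp: "Re (l p) = max (Re (l a) - q) 0"
      using pos_part_S(2)[OF aq l] S_C[OF a] l
      by (simp add: p_def of_real_def ch_diff ch_scaleR ch_1 C_scaleR)
    have lB0: "0 \<le> Re (l B)" using B l by (simp add: P_iff)
    show ?thesis
    proof (cases "q \<le> Re (l a)")
      case True
      have "Re (l p) \<le> real M"
        using lp True q ch_norm[OF l S_C[OF a]] M complex_Re_le_cmod[of "l a"] by linarith
      also have "\<dots> \<le> real M * (real N * Re (l B))"
        using mult_left_mono[OF NB[OF l True], of "real M"] by simp
      finally show ?thesis by simp
    qed (use lp lB0 in simp)
  qed
  then have "precsim sc st p B" unfolding precsim_iff[OF P_S[OF p] P_S[OF B]] by blast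
  then have "Lle sc st (Lcls sc st C p) (Ljoin sc st C U0)"
    using Ljoin_eq[OF U0(1) rU0] Lle_Lcls[OF p B] by (simp add: B_def)
  then show "\<exists>U0. finite U0 \<and> U0 \<subseteq> U \<and> Lle sc st (DD sc st C (a - of_real q)) (Ljoin sc st C U0)"
    using U0 unfolding DD_def p_def by blast
qed

lemma covers_iff:
  assumes "a \<in> S" "U \<subseteq> LC sc st C"
  shows "covers sc st C a U \<longleftrightarrow> Xa sc C a \<subseteq> (\<Union>D\<in>U. supp C D)"
  using assms covers_imp_subset subset_imp_covers by blast

end

context cstar
begin

section \<open>The isomorphism\<close>

abbreviation fiber :: "('a set \<times> ('a \<Rightarrow> complex)) set \<Rightarrow> 'a set \<Rightarrow> ('a \<Rightarrow> complex) set" where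
  "fiber W C \<equiv> {l. (C, l) \<in> W}"

lemma fiber_Psi:
  assumes C: "C \<in> CA sc st" and U: "U C \<subseteq> LC sc st C"
  shows "fiber (Psi sc st U) C = (\<Union>D\<in>U C. supp C D)"
proof -
  interpret csub sc st C by (rule csubI[OF C])
  show ?thesis
  proof (intro equalityI subsetI)
    fix l assume "l \<in> fiber (Psi sc st U) C"
    then show "l \<in> (\<Union>D\<in>U C. supp C D)" using supp_DD by (auto simp: Psi_def)
  next
    fix l assume "l \<in> (\<Union>D\<in>U C. supp C D)"
    then obtain D where D: "D \<in> U C" "l \<in> supp C D" by blast
    obtain b where b: "b \<in> P" "D = DD sc st C b" by (rule LC_E[OF subsetD[OF U D(1)]])
    then have "l \<in> Xa sc C b" using D supp_DD[OF P_S[OF b(1)]] by simp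
    moreover have "l \<in> \<Sigma>" using D by (simp add: supp_def)
    ultimately show "l \<in> fiber (Psi sc st U) C" using b D P_S[OF b(1)] C by (auto simp: Psi_def)
  qed
qed

lemma Fam_LC: "U \<in> Fam sc st \<Longrightarrow> C \<in> CA sc st \<Longrightarrow> U C \<subseteq> LC sc st C"
  unfolding Fam_def by blast

text \<open>Condition (ii) read through \<open>covers_iff\<close>: the fiber of \<open>Psi\<close>
  determines \<open>U C\<close>, which makes \<open>Psi\<close> injective.\<close>

lemma Fam_mem_iff:
  assumes U: "U \<in> Fam sc st" and C: "C \<in> CA sc st" and a: "a \<in> Csa st C"
  shows "DD sc st C a \<in> U C \<longleftrightarrow> Xa sc C a \<subseteq> fiber (Psi sc st U) C"
proof -
  have "DD sc st C a \<in> U C \<longleftrightarrow> covers sc st C a (U C)" using U C a unfolding Fam_def by blast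
  then show ?thesis
    using csub.covers_iff[OF csubI[OF C] a Fam_LC[OF U C]] fiber_Psi[where U = U, OF C Fam_LC[OF U C]] by simp
qed

lemma Psi_subset: "Psi sc st U \<subseteq> SigmaAll sc st"
  by (auto simp: Psi_def SigmaAll_def)

lemma SigmaAll_eqI:
  assumes A: "A \<subseteq> SigmaAll sc st" and B: "B \<subseteq> SigmaAll sc st"
    and eq: "\<And>C. C \<in> CA sc st \<Longrightarrow> fiber A C = fiber B C"
  shows "A = B"
proof -
  have sub: "X \<subseteq> Y" if "X \<subseteq> SigmaAll sc st" "\<And>C. C \<in> CA sc st \<Longrightarrow> fiber X C = fiber Y C" for X Y
  proof (rule subrelI)
    fix C l assume Cl: "(C, l) \<in> X"
    then have "C \<in> CA sc st" using that(1) by (auto simp: SigmaAll_def)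
    from that(2)[OF this] Cl show "(C, l) \<in> Y" by blast
  qed
  show ?thesis using sub[OF A eq] sub[OF B eq[symmetric]] by (rule equalityI)
qed

lemma Psi_OSigma:
  assumes U: "U \<in> Fam sc st"
  shows "Psi sc st U \<in> OSigma sc st"
proof -
  have "openin (gelfand_top sc C) (fiber (Psi sc st U) C)" if C: "C \<in> CA sc st" for C
  proof -
    interpret csub sc st C by (rule csubI[OF C])
    have "openin (gelfand_top sc C) (supp C D)" if D: "D \<in> U C" for D
    proof -
      obtain b where b: "b \<in> P" "D = DD sc st C b" by (rule LC_E[OF subsetD[OF Fam_LC[OF U C] D]])
      then show ?thesis using supp_DD openin_Xa by (simp add: P_S)
    qed
    then show ?thesis unfolding fiber_Psi[where U = U, OF C Fam_LC[OF U C]] by (intro openin_Union) auto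
  qed
  moreover have "(C', l') \<in> Psi sc st U"
    if l: "(C, l) \<in> Psi sc st U" and C': "C' \<in> CA sc st" "C \<subseteq> C'" and l': "l' \<in> characters sc C'" "restrict l' C = l"
    for C l C' l'
  proof -
    obtain a where C: "C \<in> CA sc st" and a: "a \<in> Csa st C" "DD sc st C a \<in> U C" "0 < Re (l a)"
      using l by (auto simp: Psi_def Xa_def)
    \<comment> \<open>Condition (i) carries the same representative to \<open>C'\<close>, where
      \<open>l'\<close> takes the value \<open>l a\<close>.\<close>
    have "DD sc st C' a \<in> U C'" using U C C' a unfolding Fam_def by blast
    moreover have "a \<in> Csa st C'" "l' a = l a" using a C' l' by (auto simp: Csa_def)
    ultimately show ?thesis using C' l' a by (auto simp: Psi_def Xa_def)
  qed
  ultimately show ?thesis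
    unfolding OSigma_def mem_Collect_eq by (intro conjI ballI allI impI Psi_subset)
qed

text \<open>The empty value off \<open>CA\<close> matches the normalization in \<open>Fam\<close>,
  so that \<open>Phi_Psi\<close> is an equality of functions.\<close>

definition Phi :: "('a set \<times> ('a \<Rightarrow> complex)) set \<Rightarrow> 'a set \<Rightarrow> 'a set set" where
  "Phi W C = (if C \<in> CA sc st then {D \<in> LC sc st C. supp C D \<subseteq> fiber W C} else {})"

lemma Phi_LC: "C \<in> CA sc st \<Longrightarrow> Phi W C \<subseteq> LC sc st C"
  by (auto simp: Phi_def)

lemma Phi_mem_iff:
  assumes "C \<in> CA sc st" "a \<in> Csa st C"
  shows "DD sc st C a \<in> Phi W C \<longleftrightarrow> Xa sc C a \<subseteq> fiber W C"
  using assms csub.DD_LC[OF csubI] csub.supp_DD[OF csubI] by (simp add: Phi_def)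

text \<open>By \<open>Xa_base\<close>, an open fiber is exhausted by the basic sets it
  contains.\<close>

lemma supp_Phi:
  assumes W: "W \<in> OSigma sc st" and C: "C \<in> CA sc st"
  shows "(\<Union>D\<in>Phi W C. supp C D) = fiber W C"
proof -
  interpret csub sc st C by (rule csubI[OF C])
  have op: "openin (gelfand_top sc C) (fiber W C)" using W C unfolding OSigma_def by blast
  have "l \<in> (\<Union>D\<in>Phi W C. supp C D)" if lW: "l \<in> fiber W C" for l
  proof -
    obtain a where a: "a \<in> S" "l \<in> Xa sc C a" "Xa sc C a \<subseteq> fiber W C"
      using Xa_base[OF op lW] by blast
    then have "DD sc st C a \<in> Phi W C" "l \<in> supp C (DD sc st C a)"
      using Phi_mem_iff[OF C] supp_DD by simp_all
    then show ?thesis by blast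
  qed
  moreover have "(\<Union>D\<in>Phi W C. supp C D) \<subseteq> fiber W C" using C by (auto simp: Phi_def)
  ultimately show ?thesis by blast
qed

lemma Phi_Fam:
  assumes W: "W \<in> OSigma sc st"
  shows "Phi W \<in> Fam sc st"
proof -
  have "DD sc st C' a \<in> Phi W C'"
    if CC: "C \<in> CA sc st" "C' \<in> CA sc st" and a: "a \<in> Csa st C" and D: "DD sc st C a \<in> Phi W C" "C \<subseteq> C'"
    for C C' a
  proof -
    have aC': "a \<in> Csa st C'" using a D by (auto simp: Csa_def)
    have "l' \<in> fiber W C'" if "l' \<in> Xa sc C' a" for l'
    proof -
      have l': "l' \<in> characters sc C'" "0 < Re (l' a)" using that by (auto simp: Xa_def)
      interpret csub sc st C by (rule csubI[OF CC(1)])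
      \<comment> \<open>Positivity of \<open>l'\<close> at \<open>a\<close> is visible after
        restriction to \<open>C\<close>; upward closure of \<open>W\<close> then leads back to
        \<open>C'\<close>.\<close>
      have "restrict l' C \<in> characters sc C"
        using l'(1) D(2) by (auto simp: characters_def C_add C_mult C_sc subset_iff)
      then have "restrict l' C \<in> Xa sc C a" using l' a by (simp add: Xa_def Csa_def)
      then have "(C, restrict l' C) \<in> W" using D(1) Phi_mem_iff[OF CC(1) a] by blast
      then have "(C', l') \<in> W" using W CC(2) D(2) l'(1) unfolding OSigma_def by blast
      then show ?thesis by simp
    qed
    then show ?thesis using Phi_mem_iff[OF CC(2) aC'] by blast
  qed
  \<comment> \<open>The supports of all classes in \<open>Phi W C\<close> already fill the fiber, so
    covering gives nothing beyond inclusion in it.\<close>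
  moreover have "DD sc st C a \<in> Phi W C \<longleftrightarrow> covers sc st C a (Phi W C)"
    if C: "C \<in> CA sc st" and a: "a \<in> Csa st C" for C a
    using Phi_mem_iff[OF C a] csub.covers_iff[OF csubI[OF C] a Phi_LC[OF C]] supp_Phi[OF W C] by simp
  moreover have "Phi W C = {}" if "C \<notin> CA sc st" for C using that by (simp add: Phi_def)
  ultimately show ?thesis using Phi_LC unfolding Fam_def by blast
qed

lemma Psi_Phi:
  assumes W: "W \<in> OSigma sc st"
  shows "Psi sc st (Phi W) = W"
proof (rule SigmaAll_eqI[OF Psi_subset])
  show "W \<subseteq> SigmaAll sc st" using W by (simp add: OSigma_def)
  show "fiber (Psi sc st (Phi W)) C = fiber W C" if "C \<in> CA sc st" for C
    using fiber_Psi[where U = "Phi W", OF that Phi_LC[OF that]] supp_Phi[OF W that] by simp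
qed

lemma Phi_Psi:
  assumes U: "U \<in> Fam sc st"
  shows "Phi (Psi sc st U) = U"
proof
  fix C
  show "Phi (Psi sc st U) C = U C"
  proof (cases "C \<in> CA sc st")
    case C: True
    interpret csub sc st C by (rule csubI[OF C])
    have "D \<in> Phi (Psi sc st U) C \<longleftrightarrow> D \<in> U C" if D: "D \<in> LC sc st C" for D
    proof -
      obtain b where b: "b \<in> P" "D = DD sc st C b" by (rule LC_E[OF D])
      then show ?thesis using Fam_mem_iff[OF U C] Phi_mem_iff[OF C] by (simp add: P_S)
    qed
    then show ?thesis using Phi_LC[OF C] Fam_LC[OF U C] by blast
  next
    case False
    then show ?thesis using U by (auto simp: Phi_def Fam_def)
  qed
qed

lemma bij_betw_Psi: "bij_betw (Psi sc st) (Fam sc st) (OSigma sc st)"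
  by (rule bij_betw_byWitness[where f' = Phi]) (auto simp: Phi_Psi Psi_Phi Psi_OSigma Phi_Fam)

section \<open>Preservation of finite meets and arbitrary joins\<close>

lemma Psi_Fmeet:
  assumes U: "U \<in> Fam sc st" and V: "V \<in> Fam sc st"
  shows "Psi sc st (Fmeet U V) = Psi sc st U \<inter> Psi sc st V"
proof (intro equalityI subsetI)
  fix x assume "x \<in> Psi sc st (Fmeet U V)"
  then show "x \<in> Psi sc st U \<inter> Psi sc st V" by (auto simp: Psi_def Fmeet_def)
next
  fix x assume x: "x \<in> Psi sc st U \<inter> Psi sc st V"
  obtain C l where xCl: "x = (C, l)" by fastforce
  have C: "C \<in> CA sc st" and l: "l \<in> characters sc C" using x xCl by (auto simp: Psi_def)
  interpret csub sc st C by (rule csubI[OF C])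
  obtain a where a: "a \<in> S" "DD sc st C a \<in> U C" "0 < Re (l a)"
    using x xCl by (auto simp: Psi_def Xa_def)
  obtain b where b: "b \<in> S" "DD sc st C b \<in> V C" "0 < Re (l b)"
    using x xCl by (auto simp: Psi_def Xa_def)
  \<comment> \<open>The two witnesses may differ; the product of positive parts is positive exactly
    where both are, hence a common witness.\<close>
  define c where "c = pos_part sc st a * pos_part sc st b"
  have c: "c \<in> S" using a b by (auto simp: c_def intro!: S_mult pos_part_S)
  have kc: "Re (k c) = max (Re (k a)) 0 * max (Re (k b)) 0" if k: "k \<in> \<Sigma>" for k
  proof -
    have "k c = of_real (max (Re (k a)) 0) * of_real (max (Re (k b)) 0)"
      using ch_real[OF k pos_part_S(1)[OF a(1)]] ch_real[OF k pos_part_S(1)[OF b(1)]]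
      by (simp add: c_def ch_mult[OF k] S_C pos_part_S a b k)
    then show ?thesis by (simp flip: of_real_mult)
  qed
  then have Xc: "Xa sc C c = Xa sc C a \<inter> Xa sc C b"
    by (auto simp: Xa_def zero_less_mult_iff max_def split: if_splits)
  \<comment> \<open>By \<open>Fam_mem_iff\<close> both families are closed under passing to smaller
    sets \<open>Xa\<close>.\<close>
  have "DD sc st C c \<in> U C" "DD sc st C c \<in> V C"
    using Fam_mem_iff[OF U C] Fam_mem_iff[OF V C] a b c Xc by auto
  moreover have "l \<in> Xa sc C c" unfolding Xc using l a b by (simp add: Xa_def)
  ultimately show "x \<in> Psi sc st (Fmeet U V)"
    using xCl C l c by (auto simp: Psi_def Fmeet_def)
qed

lemma Psi_Ftop: "Psi sc st (Ftop sc st) = SigmaAll sc st"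
proof -
  have "(C, l) \<in> Psi sc st (Ftop sc st)" if C: "C \<in> CA sc st" and l: "l \<in> characters sc C" for C l
  proof -
    interpret csub sc st C by (rule csubI[OF C])
    have "DD sc st C 1 \<in> LC sc st C" "l \<in> Xa sc C 1" using DD_LC l by (auto simp: Xa_def ch_1)
    then show ?thesis using C l S_1 by (auto simp: Psi_def Ftop_def)
  qed
  then show ?thesis using Psi_subset by (auto simp: SigmaAll_def)
qed

text \<open>Closing under covers adds only classes whose support is already in the union, so the
  union of supports does not change.\<close>

lemma Psi_Fjoin:
  assumes Us: "Us \<subseteq> Fam sc st"
  shows "Psi sc st (Fjoin sc st Us) = (\<Union>U\<in>Us. Psi sc st U)"
proof (rule SigmaAll_eqI[OF Psi_subset])
  show "(\<Union>U\<in>Us. Psi sc st U) \<subseteq> SigmaAll sc st" using Psi_subset by blast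
  show "fiber (Psi sc st (Fjoin sc st Us)) C = fiber (\<Union>U\<in>Us. Psi sc st U) C" if C: "C \<in> CA sc st" for C
  proof -
    interpret csub sc st C by (rule csubI[OF C])
    have LC: "(\<Union>U\<in>Us. U C) \<subseteq> LC sc st C" using Us Fam_LC[OF _ C] by blast
    have "fiber (Psi sc st (Fjoin sc st Us)) C = (\<Union>D\<in>Fjoin sc st Us C. supp C D)"
      using C by (intro fiber_Psi[OF C]) (auto simp: Fjoin_def)
    also have "\<dots> = (\<Union>D\<in>(\<Union>U\<in>Us. U C). supp C D)"
    proof (intro equalityI UN_least)
      fix D assume "D \<in> Fjoin sc st Us C"
      then obtain a where "a \<in> S" "D = DD sc st C a" "covers sc st C a (\<Union>U\<in>Us. U C)"
        using C by (auto simp: Fjoin_def)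
      then show "supp C D \<subseteq> (\<Union>D\<in>(\<Union>U\<in>Us. U C). supp C D)" using covers_iff[OF _ LC] supp_DD by simp
    next
      fix D assume D: "D \<in> (\<Union>U\<in>Us. U C)"
      obtain b where b: "b \<in> P" "D = DD sc st C b" by (rule LC_E[OF subsetD[OF LC D]])
      have "Xa sc C b \<subseteq> (\<Union>D\<in>(\<Union>U\<in>Us. U C). supp C D)" using D b supp_DD[OF P_S[OF b(1)]] by blast
      then have "covers sc st C b (\<Union>U\<in>Us. U C)" using covers_iff[OF P_S[OF b(1)] LC] by simp
      then have "D \<in> Fjoin sc st Us C" using C D LC b P_S[OF b(1)] unfolding Fjoin_def by auto
      then show "supp C D \<subseteq> (\<Union>D\<in>Fjoin sc st Us C. supp C D)" by blast
    qed
    also have "\<dots> = (\<Union>U\<in>Us. \<Union>D\<in>U C. supp C D)" by blast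
    also have "\<dots> = (\<Union>U\<in>Us. fiber (Psi sc st U) C)"
    proof (rule SUP_cong[OF refl])
      fix U assume "U \<in> Us"
      then have "U C \<subseteq> LC sc st C" using Us C by (intro Fam_LC) auto
      then show "(\<Union>D\<in>U C. supp C D) = fiber (Psi sc st U) C"
        using fiber_Psi[where U = U, OF C] by simp
    qed
    also have "\<dots> = fiber (\<Union>U\<in>Us. Psi sc st U) C" by blast
    finally show ?thesis .
  qed
qed

end

theorem theorem2p17:
  fixes sc :: "complex \<Rightarrow> 'a::{real_normed_algebra_1,banach} \<Rightarrow> 'a"
    and st :: "'a \<Rightarrow> 'a"
  assumes "cstar_algebra sc st"
  shows "(\<forall>U\<in>Fam sc st. Psi sc st U \<in> OSigma sc st)
    \<and> bij_betw (Psi sc st) (Fam sc st) (OSigma sc st)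
    \<and> (\<forall>U\<in>Fam sc st. \<forall>V\<in>Fam sc st. Psi sc st (Fmeet U V) = Psi sc st U \<inter> Psi sc st V)
    \<and> Psi sc st (Ftop sc st) = SigmaAll sc st
    \<and> (\<forall>Us. Us \<subseteq> Fam sc st \<longrightarrow> Psi sc st (Fjoin sc st Us) = (\<Union>U\<in>Us. Psi sc st U))"
proof -
  interpret cstar sc st by unfold_locales (rule assms)
  show ?thesis using Psi_OSigma bij_betw_Psi Psi_Fmeet Psi_Ftop Psi_Fjoin by blast
qed

end
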